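(* Let $\mathcal C$, $\Sigma_{\mathsf v}$, $\Sigma_{\mathsf c}$, $D$, $\Theta$, $\theta$ be as in the context, let $T$ be an $\omega$-continuous strong monad on $\mathcal C$, and let $(\rho^{\mathsf v},\rho^{\mathsf c},\chi)$ be a strongly separated abstract higher-order GSOS law whose distributive law $\chi$ is $\omega$-continuous. Let $\xi$ be the big-step transformation induced by $(\rho^{\mathsf v},\rho^{\mathsf c})$, let $\hat\zeta\colon\mu\Sigma\to TS_{\mathsf v}$ be the induced big-step semantics and $\hat\beta\colon\mu\Sigma\to TS_{\mathsf v}$ the multi-step small-step semantics (all as defined in the context). Then $\hat\zeta=\hat\beta$.
   Context: Conventions: $\mathcal C$ is a distributive category (finite products and coproducts, and the canonical morphisms $[\mathrm{id}\times\mathrm{inl},\mathrm{id}\times\mathrm{inr}]\colon X\times Y+X\times Z\to X\times(Y+Z)$ are isomorphisms). $\mathrm{inl},\mathrm{inr}$ are coproduct injections, $[f,g]$ copairing, $\langle f,g\rangle$ pairing, $\mathrm{fst},\mathrm{snd}$ projections, $\nabla=[\mathrm{id},\mathrm{id}]\colon X+X\to X$. Syntax: $\Sigma_{\mathsf v}\colon\mathcal C\to\mathcal C$ and $\Sigma_{\mathsf c}\colon\mathcal C\times\mathcal C\to\mathcal C$ are functors, and $\Sigma X=\Sigma_{\mathsf v}X+\Sigma_{\mathsf c}(X,X)$. Free $\Sigma$-algebras exist; $(\Sigma^\star,\eta^\Sigma,\mu^\Sigma)$ is the free monad on $\Sigma$ with algebra structures $\iota_X\colon\Sigma\Sigma^\star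 X\to\Sigma^\star X$; $\iota^{\mathsf v}=\iota\circ\mathrm{inl}\colon\Sigma_{\mathsf v}\Sigma^\star X\to\Sigma^\star X$, $\iota^{\mathsf c}=\iota\circ\mathrm{inr}\colon\Sigma_{\mathsf c}(\Sigma^\star X,\Sigma^\star X)\to\Sigma^\star X$. $\mu\Sigma=\Sigma^\star 0$ is the initial $\Sigma$-algebra with invertible structure $\iota\colon\Sigma\mu\Sigma\to\mu\Sigma$; $S_{\mathsf v}=\Sigma_{\mathsf v}(\mu\Sigma)$, $S_{\mathsf c}=\Sigma_{\mathsf c}(\mu\Sigma,\mu\Sigma)$, so $\iota^{-1}\colon\mu\Sigma\to S_{\mathsf v}+S_{\mathsf c}$. For every $X$, $\nabla^\sharp:=\mu^\Sigma_X\circ\Sigma^\star\nabla\colon\Sigma^\star(\Sigma^\star X+\Sigma^\star X)\to\Sigma^\star X$ (for $X=0$: $\nabla^\sharp\colon\Sigma^\star(\mu\Sigma+\mu\Sigma)\to\mu\Sigma$), and $\mu^\Sigma_0\colon\Sigma^\star\mu\Sigma\to\mu\Sigma$. Behaviour: $T$ is a strong monad with unit $\eta^T$, multiplication $m^T$, strength $\tau_{X,Y}\colon X\times TY\to T(X\times Y)$; for $f\colon X\to TZ$, $f^\sharp=m^T\circ Tf$; for $f\colon X\to TZ,g\colon Y\to TW$, $f\boxplus g=[T\mathrm{inl}\circ f,T\mathrm{inr}\circ g]\colon X+Y\to T(Z+W)$. $D\colon\mathcal C^{op}\times\mathcal C\to\mathcal C$ is a functor and $B(X,Y)=TD(X,Y)+TY$.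 A separated abstract higher-order GSOS law is a triple $(\rho^{\mathsf v},\rho^{\mathsf c},\chi)$ of: a family $\rho^{\mathsf v}_X\colon\Sigma_{\mathsf v}X\to D(X,\Sigma^\star X)$ dinatural in $X$; a family $\rho^{\mathsf c}_{X,Y}\colon\Sigma_{\mathsf c}(X\times B(X,Y),X)\to T\Sigma^\star(X+Y)$ dinatural in $X$ and natural in $Y$; and a family $\chi_{X,Y}\colon\Sigma_{\mathsf c}(TX,Y)\to T\Sigma_{\mathsf c}(X,Y)$, natural in $X,Y$, which for each $Y$ is a distributive law of the monad $T$ over the functor $\Sigma_{\mathsf c}(-,Y)$ ($\chi\circ\Sigma_{\mathsf c}(\eta^T,\mathrm{id})=\eta^T$, $\chi\circ\Sigma_{\mathsf c}(m^T,\mathrm{id})=m^T\circ T\chi\circ\chi$). Put $\rho^{\mathsf{cv}}_{X,Y}=\rho^{\mathsf c}_{X,Y}\circ\Sigma_{\mathsf c}(\mathrm{id}\times\mathrm{inl},\mathrm{id})\colon\Sigma_{\mathsf c}(X\times TD(X,Y),X)\to T\Sigma^\star(X+Y)$. Standing assumption: there are a functor $\Theta\colon\mathcal C\times\mathcal C\times\mathcal C\to\mathcal C$ and a natural transformation $\theta_{X,Y,Z}\colon\Theta(X,Y,Z)\to\Sigma_{\mathsf c}(X+Y,Z)$ such that $\Sigma_{\mathsf c}(X,Z)\xrightarrow{\Sigma_{\mathsf c}(\mathrm{inl},\mathrm{id})}\Sigma_{\mathsf c}(X+Y,Z)\xleftarrow{\theta}\Theta(X,Y,Z)$ is a coproduct,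 naturally in $X,Y,Z$. Strong separation: the law is strongly separated if for all $X,Y$, with $\theta=\theta_{X\times TD(X,Y),\,X\times TY,\,X}$ and $\delta=[\mathrm{id}\times\mathrm{inl},\mathrm{id}\times\mathrm{inr}]\colon X\times TD(X,Y)+X\times TY\to X\times B(X,Y)$, $\rho^{\mathsf c}_{X,Y}\circ\Sigma_{\mathsf c}(\delta,\mathrm{id}_X)\circ\theta=T(\iota^{\mathsf c}\circ\Sigma_{\mathsf c}(\eta^\Sigma,\eta^\Sigma))\circ\chi_{X+Y,X+Y}\circ\Sigma_{\mathsf c}((T\mathrm{fst}\circ\tau)\boxplus\mathrm{snd},\ \mathrm{inl})\circ\theta$ as morphisms $\Theta(X\times TD(X,Y),X\times TY,X)\to T\Sigma^\star(X+Y)$. Operational model: $\gamma^{\mathsf v}=\eta^T\circ D(\mathrm{id},\mu^\Sigma_0)\circ\rho^{\mathsf v}_{\mu\Sigma}\colon S_{\mathsf v}\to TD(\mu\Sigma,\mu\Sigma)$, and $\gamma^{\mathsf c}\colon S_{\mathsf c}\to T\mu\Sigma$ is the unique morphism with $\gamma^{\mathsf c}\circ\Sigma_{\mathsf c}(\iota,\mathrm{id})=T\nabla^\sharp\circ\rho^{\mathsf c}_{\mu\Sigma,\mu\Sigma}\circ\Sigma_{\mathsf c}(\langle\iota,\gamma^{\mathsf v}+\gamma^{\mathsf c}\rangle,\mathrm{id})$ as morphisms $\Sigma_{\mathsf c}(S_{\mathsf v}+S_{\mathsf c},\mu\Sigma)\to T\mu\Sigma$ (it exists and is unique). $\omega$-continuity: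 $T$ is $\omega$-continuous if every hom-set $\mathcal C(X,TY)$ carries a partial order $\sqsubseteq$ making it an $\omega$-cpo with least element $\bot$, such that Kleisli composition $(f,g)\mapsto g^\sharp\circ f$ is $\omega$-continuous (hence monotone) in each argument, $\tau\circ(\mathrm{id}\times\bigsqcup_i f_i)=\bigsqcup_i\tau\circ(\mathrm{id}\times f_i)$, $[\bigsqcup_i f_i,\bigsqcup_i g_i]=\bigsqcup_i[f_i,g_i]$, $\tau\circ(\mathrm{id}\times\bot)=\bot$ and $f^\sharp\circ\bot=\bot$. $\chi$ is $\omega$-continuous if each map $f\mapsto\chi_{Y,Z}\circ\Sigma_{\mathsf c}(f,\mathrm{id}_Z)$, $\mathcal C(X,TY)\to\mathcal C(\Sigma_{\mathsf c}(X,Z),T\Sigma_{\mathsf c}(Y,Z))$, is $\omega$-continuous. $\mu f.\,F(f)$ denotes the least fixpoint. Small-step multi-step semantics: $\beta=\mu f.\,[\eta^T,f]^\sharp\circ T\iota^{-1}\circ\gamma^{\mathsf c}\colon S_{\mathsf c}\to TS_{\mathsf v}$ and $\hat\beta=[\eta^T,\beta]\circ\iota^{-1}\colon\mu\Sigma\to TS_{\mathsf v}$. Big-step: $\xi_X=T\nabla^\sharp\circ\rho^{\mathsf{cv}}_{\Sigma^\star X,\Sigma^\star X}\circ\Sigma_{\mathsf c}(\langle\iota^{\mathsf v},\eta^T\circ D(\mathrm{id},\mu^\Sigma_X)\circ\rho^{\mathsf v}_{\Sigma^\star X}\rangle,\mathrm{id})\circ\Sigma_{\mathsf c}(\Sigma_{\mathsf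 v}\eta^\Sigma_X,\eta^\Sigma_X)\colon\Sigma_{\mathsf c}(\Sigma_{\mathsf v}X,X)\to T\Sigma^\star X$, and $\hat\zeta=\mu f.\,[\eta^T,\ f^\sharp\circ T\mu^\Sigma_0\circ\xi_{\mu\Sigma}^\sharp\circ\chi_{S_{\mathsf v},\mu\Sigma}\circ\Sigma_{\mathsf c}(f,\mathrm{id})]\circ\iota^{-1}\colon\mu\Sigma\to TS_{\mathsf v}$. *)

theory Defs
  imports Main
begin

text \<open>Categories. Every element of the type \<open>'o\<close> is an object; the arrows form a subset of the
  type \<open>'m\<close>. Composition is written in the usual applicative order.\<close>

record ('o, 'm) cat =
  arrs :: "'m set"
  src :: "'m \<Rightarrow> 'o"
  tgt :: "'m \<Rightarrow> 'o"
  idn :: "'o \<Rightarrow> 'm"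
  cmp :: "'m \<Rightarrow> 'm \<Rightarrow> 'm" (infixr "\<cdot>\<index>" 75)

definition hom :: "('o, 'm, 'x) cat_scheme \<Rightarrow> 'o \<Rightarrow> 'o \<Rightarrow> 'm set" where
  "hom C X Y = {f \<in> arrs C. src C f = X \<and> tgt C f = Y}"

locale category =
  fixes C :: "('o, 'm, 'x) cat_scheme" (structure)
  assumes idn_hom: "idn C X \<in> hom C X X"
    and cmp_hom: "\<lbrakk>f \<in> hom C X Y; g \<in> hom C Y Z\<rbrakk> \<Longrightarrow> g \<cdot> f \<in> hom C X Z"
    and cmp_idn_left: "f \<in> hom C X Y \<Longrightarrow> idn C Y \<cdot> f = f"
    and cmp_idn_right: "f \<in> hom C X Y \<Longrightarrow> f \<cdot> idn C X = f"
    and cmp_assoc: "\<lbrakk>f \<in> hom C W X; g \<in> hom C X Y; h \<in> hom C Y Z\<rbrakk>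
      \<Longrightarrow> (h \<cdot> g) \<cdot> f = h \<cdot> (g \<cdot> f)"

definition op_cat :: "('o, 'm, 'x) cat_scheme \<Rightarrow> ('o, 'm) cat" where
  "op_cat C = \<lparr>arrs = arrs C, src = tgt C, tgt = src C, idn = idn C, cmp = (\<lambda>g f. f \<cdot>\<^bsub>C\<^esub> g)\<rparr>"

definition prod_cat ::
  "('o, 'm, 'x) cat_scheme \<Rightarrow> ('p, 'n, 'y) cat_scheme \<Rightarrow> ('o \<times> 'p, 'm \<times> 'n) cat"
  (infixr "\<times>\<^sub>C" 80) where
  "A \<times>\<^sub>C B = \<lparr>arrs = arrs A \<times> arrs B,
     src = (\<lambda>(f, g). (src A f, src B g)),
     tgt = (\<lambda>(f, g). (tgt A f, tgt B g)),
     idn = (\<lambda>(X, Y). (idn A X, idn B Y)),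
     cmp = (\<lambda>(g, g') (f, f'). (g \<cdot>\<^bsub>A\<^esub> f, g' \<cdot>\<^bsub>B\<^esub> f'))\<rparr>"

definition is_iso :: "('o, 'm, 'x) cat_scheme \<Rightarrow> 'm \<Rightarrow> bool" where
  "is_iso C f \<longleftrightarrow> f \<in> arrs C \<and> (\<exists>g \<in> hom C (tgt C f) (src C f).
     g \<cdot>\<^bsub>C\<^esub> f = idn C (src C f) \<and> f \<cdot>\<^bsub>C\<^esub> g = idn C (tgt C f))"

definition inv_arr :: "('o, 'm, 'x) cat_scheme \<Rightarrow> 'm \<Rightarrow> 'm" where
  "inv_arr C f = (THE g. g \<in> hom C (tgt C f) (src C f) \<and>
     g \<cdot>\<^bsub>C\<^esub> f = idn C (src C f) \<and> f \<cdot>\<^bsub>C\<^esub> g = idn C (tgt C f))"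

definition is_coproduct ::
  "('o, 'm, 'x) cat_scheme \<Rightarrow> 'o \<Rightarrow> 'o \<Rightarrow> 'o \<Rightarrow> 'm \<Rightarrow> 'm \<Rightarrow> bool" where
  "is_coproduct C X Y P i j \<longleftrightarrow> i \<in> hom C X P \<and> j \<in> hom C Y P \<and>
     (\<forall>Z. \<forall>f \<in> hom C X Z. \<forall>g \<in> hom C Y Z.
        \<exists>!h. h \<in> hom C P Z \<and> h \<cdot>\<^bsub>C\<^esub> i = f \<and> h \<cdot>\<^bsub>C\<^esub> j = g)"


text \<open>Categories with chosen finite products \<open>\<otimes>\<close>, \<open>one\<close> and coproducts \<open>\<oplus>\<close>, \<open>zero\<close>.
  Projections and injections are indexed by both components.\<close>

record ('o, 'm) bicart = "('o, 'm) cat" +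
  prd :: "'o \<Rightarrow> 'o \<Rightarrow> 'o" (infixr "\<otimes>\<index>" 80)
  pfst :: "'o \<Rightarrow> 'o \<Rightarrow> 'm"
  psnd :: "'o \<Rightarrow> 'o \<Rightarrow> 'm"
  pair :: "'m \<Rightarrow> 'm \<Rightarrow> 'm" ("(\<open>indent=1\<close>\<langle>_,/ _\<rangle>\<index>)")
  one :: "'o"
  cop :: "'o \<Rightarrow> 'o \<Rightarrow> 'o" (infixr "\<oplus>\<index>" 78)
  cinl :: "'o \<Rightarrow> 'o \<Rightarrow> 'm"
  cinr :: "'o \<Rightarrow> 'o \<Rightarrow> 'm"
  copair :: "'m \<Rightarrow> 'm \<Rightarrow> 'm" ("(\<open>indent=1\<close>\<lblot>_,/ _\<rblot>\<index>)")
  zero :: "'o"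

definition pmap :: "('o, 'm, 'x) bicart_scheme \<Rightarrow> 'm \<Rightarrow> 'm \<Rightarrow> 'm" (infixr "\<otimes>\<^sub>m\<index>" 80) where
  "pmap C f g = \<langle>f \<cdot>\<^bsub>C\<^esub> pfst C (src C f) (src C g), g \<cdot>\<^bsub>C\<^esub> psnd C (src C f) (src C g)\<rangle>\<^bsub>C\<^esub>"

definition cmap :: "('o, 'm, 'x) bicart_scheme \<Rightarrow> 'm \<Rightarrow> 'm \<Rightarrow> 'm" (infixr "\<oplus>\<^sub>m\<index>" 78) where
  "cmap C f g = \<lblot>cinl C (tgt C f) (tgt C g) \<cdot>\<^bsub>C\<^esub> f, cinr C (tgt C f) (tgt C g) \<cdot>\<^bsub>C\<^esub> g\<rblot>\<^bsub>C\<^esub>"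

locale distributive_category = category C
  for C :: "('o, 'm) bicart" (structure) +
  assumes pfst_hom: "pfst C X Y \<in> hom C (X \<otimes> Y) X"
    and psnd_hom: "psnd C X Y \<in> hom C (X \<otimes> Y) Y"
    and pair_hom: "\<lbrakk>f \<in> hom C Z X; g \<in> hom C Z Y\<rbrakk> \<Longrightarrow> \<langle>f, g\<rangle> \<in> hom C Z (X \<otimes> Y)"
    and pfst_pair: "\<lbrakk>f \<in> hom C Z X; g \<in> hom C Z Y\<rbrakk> \<Longrightarrow> pfst C X Y \<cdot> \<langle>f, g\<rangle> = f"
    and psnd_pair: "\<lbrakk>f \<in> hom C Z X; g \<in> hom C Z Y\<rbrakk> \<Longrightarrow> psnd C X Y \<cdot> \<langle>f, g\<rangle> = g"
    and pair_unique: "h \<in> hom C Z (X \<otimes> Y) \<Longrightarrow> \<langle>pfst C X Y \<cdot> h, psnd C X Y \<cdot> h\<rangle> = h"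
    and terminal: "\<exists>!f. f \<in> hom C X (one C)"
    and cinl_hom: "cinl C X Y \<in> hom C X (X \<oplus> Y)"
    and cinr_hom: "cinr C X Y \<in> hom C Y (X \<oplus> Y)"
    and copair_hom: "\<lbrakk>f \<in> hom C X Z; g \<in> hom C Y Z\<rbrakk> \<Longrightarrow> \<lblot>f, g\<rblot> \<in> hom C (X \<oplus> Y) Z"
    and copair_cinl: "\<lbrakk>f \<in> hom C X Z; g \<in> hom C Y Z\<rbrakk> \<Longrightarrow> \<lblot>f, g\<rblot> \<cdot> cinl C X Y = f"
    and copair_cinr: "\<lbrakk>f \<in> hom C X Z; g \<in> hom C Y Z\<rbrakk> \<Longrightarrow> \<lblot>f, g\<rblot> \<cdot> cinr C X Y = g"
    and copair_unique: "h \<in> hom C (X \<oplus> Y) Z \<Longrightarrow> \<lblot>h \<cdot> cinl C X Y, h \<cdot> cinr C X Y\<rblot> = h"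
    and initial: "\<exists>!f. f \<in> hom C (zero C) X"
    and distributive: "is_iso C \<lblot>idn C X \<otimes>\<^sub>m cinl C Y Z, idn C X \<otimes>\<^sub>m cinr C Y Z\<rblot>"


record ('o, 'm, 'p, 'n) func =
  omap :: "'o \<Rightarrow> 'p"
  amap :: "'m \<Rightarrow> 'n"

definition is_functor ::
  "('o, 'm, 'x) cat_scheme \<Rightarrow> ('p, 'n, 'y) cat_scheme \<Rightarrow> ('o, 'm, 'p, 'n, 'z) func_scheme \<Rightarrow> bool"
  where
  "is_functor A B F \<longleftrightarrow>
     (\<forall>X Y. \<forall>f \<in> hom A X Y. amap F f \<in> hom B (omap F X) (omap F Y)) \<and>
     (\<forall>X. amap F (idn A X) = idn B (omap F X)) \<and>
     (\<forall>X Y Z. \<forall>f \<in> hom A X Y. \<forall>g \<in> hom A Y Z. amap F (g \<cdot>\<^bsub>A\<^esub> f) = amap F g \<cdot>\<^bsub>B\<^esub> amap F f)"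


text \<open>Strong monads, with unit \<open>munit\<close>, multiplication \<open>mmult\<close> and strength
  \<open>mstr X Y : X \<otimes> T Y \<rightarrow> T (X \<otimes> Y)\<close>.\<close>

record ('o, 'm) smonad = "('o, 'm, 'o, 'm) func" +
  munit :: "'o \<Rightarrow> 'm"
  mmult :: "'o \<Rightarrow> 'm"
  mstr :: "'o \<Rightarrow> 'o \<Rightarrow> 'm"

definition passoc :: "('o, 'm) bicart \<Rightarrow> 'o \<Rightarrow> 'o \<Rightarrow> 'o \<Rightarrow> 'm" where
  "passoc C X Y Z =
     \<langle>pfst C X Y \<cdot>\<^bsub>C\<^esub> pfst C (X \<otimes>\<^bsub>C\<^esub> Y) Z,
      \<langle>psnd C X Y \<cdot>\<^bsub>C\<^esub> pfst C (X \<otimes>\<^bsub>C\<^esub> Y) Z, psnd C (X \<otimes>\<^bsub>C\<^esub> Y) Z\<rangle>\<^bsub>C\<^esub>\<rangle>\<^bsub>C\<^esub>"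

locale strong_monad =
  fixes C :: "('o, 'm) bicart" (structure) and T :: "('o, 'm) smonad"
  assumes functor_T: "is_functor C C T"
    and munit_hom: "munit T X \<in> hom C X (omap T X)"
    and mmult_hom: "mmult T X \<in> hom C (omap T (omap T X)) (omap T X)"
    and mstr_hom: "mstr T X Y \<in> hom C (X \<otimes> omap T Y) (omap T (X \<otimes> Y))"
    and munit_natural: "f \<in> hom C X Y \<Longrightarrow> amap T f \<cdot> munit T X = munit T Y \<cdot> f"
    and mmult_natural: "f \<in> hom C X Y \<Longrightarrow>
      amap T f \<cdot> mmult T X = mmult T Y \<cdot> amap T (amap T f)"
    and mstr_natural: "\<lbrakk>f \<in> hom C X X'; g \<in> hom C Y Y'\<rbrakk> \<Longrightarrow>
      amap T (f \<otimes>\<^sub>m g) \<cdot> mstr T X Y = mstr T X' Y' \<cdot> (f \<otimes>\<^sub>m amap T g)"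
    and mmult_munit: "mmult T X \<cdot> munit T (omap T X) = idn C (omap T X)"
    and mmult_map_munit: "mmult T X \<cdot> amap T (munit T X) = idn C (omap T X)"
    and mmult_mmult: "mmult T X \<cdot> mmult T (omap T X) = mmult T X \<cdot> amap T (mmult T X)"
    and mstr_one: "amap T (psnd C (one C) X) \<cdot> mstr T (one C) X = psnd C (one C) (omap T X)"
    and mstr_assoc: "amap T (passoc C X Y Z) \<cdot> mstr T (X \<otimes> Y) Z =
      mstr T X (Y \<otimes> Z) \<cdot> (idn C X \<otimes>\<^sub>m mstr T Y Z) \<cdot> passoc C X Y (omap T Z)"
    and mstr_munit: "mstr T X Y \<cdot> (idn C X \<otimes>\<^sub>m munit T Y) = munit T (X \<otimes> Y)"
    and mstr_mmult: "mstr T X Y \<cdot> (idn C X \<otimes>\<^sub>m mmult T Y) =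
      mmult T (X \<otimes> Y) \<cdot> amap T (mstr T X Y) \<cdot> mstr T X (omap T Y)"

text \<open>Kleisli extension of \<open>f : X \<rightarrow> T Z\<close> and the sum of \<open>f : X \<rightarrow> T Z\<close> and \<open>g : Y \<rightarrow> T W\<close>. The
  objects \<open>Z\<close>, \<open>W\<close> are explicit since the target \<open>T Z\<close> of an arrow need not determine \<open>Z\<close>.\<close>

definition klift :: "('o, 'm) bicart \<Rightarrow> ('o, 'm) smonad \<Rightarrow> 'o \<Rightarrow> 'm \<Rightarrow> 'm" where
  "klift C T Z f = mmult T Z \<cdot>\<^bsub>C\<^esub> amap T f"

definition ksum :: "('o, 'm) bicart \<Rightarrow> ('o, 'm) smonad \<Rightarrow> 'o \<Rightarrow> 'o \<Rightarrow> 'm \<Rightarrow> 'm \<Rightarrow> 'm" where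
  "ksum C T Z W f g = \<lblot>amap T (cinl C Z W) \<cdot>\<^bsub>C\<^esub> f, amap T (cinr C Z W) \<cdot>\<^bsub>C\<^esub> g\<rblot>\<^bsub>C\<^esub>"


definition omega_chain :: "'a set \<Rightarrow> ('a \<Rightarrow> 'a \<Rightarrow> bool) \<Rightarrow> (nat \<Rightarrow> 'a) \<Rightarrow> bool" where
  "omega_chain A le f \<longleftrightarrow> (\<forall>i. f i \<in> A \<and> le (f i) (f (Suc i)))"

definition is_sup :: "'a set \<Rightarrow> ('a \<Rightarrow> 'a \<Rightarrow> bool) \<Rightarrow> (nat \<Rightarrow> 'a) \<Rightarrow> 'a \<Rightarrow> bool" where
  "is_sup A le f s \<longleftrightarrow> s \<in> A \<and> (\<forall>i. le (f i) s) \<and> (\<forall>u \<in> A. (\<forall>i. le (f i) u) \<longrightarrow> le s u)"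

definition is_bot :: "'a set \<Rightarrow> ('a \<Rightarrow> 'a \<Rightarrow> bool) \<Rightarrow> 'a \<Rightarrow> bool" where
  "is_bot A le b \<longleftrightarrow> b \<in> A \<and> (\<forall>u \<in> A. le b u)"

definition omega_cpo :: "'a set \<Rightarrow> ('a \<Rightarrow> 'a \<Rightarrow> bool) \<Rightarrow> bool" where
  "omega_cpo A le \<longleftrightarrow> reflp_on A le \<and> transp_on A le \<and> antisymp_on A le \<and>
     (\<forall>f. omega_chain A le f \<longrightarrow> (\<exists>s. is_sup A le f s)) \<and> (\<exists>b. is_bot A le b)"

text \<open>Monotonicity is implied: apply the condition to the chain \<open>x, y, y, \<dots>\<close>.\<close>

definition omega_cont ::
  "'a set \<Rightarrow> ('a \<Rightarrow> 'a \<Rightarrow> bool) \<Rightarrow> 'b set \<Rightarrow> ('b \<Rightarrow> 'b \<Rightarrow> bool) \<Rightarrow> ('a \<Rightarrow> 'b) \<Rightarrow> bool" where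
  "omega_cont A le A' le' \<Phi> \<longleftrightarrow>
     (\<forall>f s. omega_chain A le f \<longrightarrow> is_sup A le f s \<longrightarrow> is_sup A' le' (\<lambda>i. \<Phi> (f i)) (\<Phi> s))"

definition least_fixpoint :: "'a set \<Rightarrow> ('a \<Rightarrow> 'a \<Rightarrow> bool) \<Rightarrow> ('a \<Rightarrow> 'a) \<Rightarrow> 'a" where
  "least_fixpoint A le \<Phi> =
     (THE f. f \<in> A \<and> \<Phi> f = f \<and> (\<forall>g \<in> A. \<Phi> g = g \<longrightarrow> le f g))"

text \<open>\<open>le X Y\<close> is the order on the hom-set from \<open>X\<close> to \<open>T Y\<close>.\<close>

locale omega_continuous_monad = strong_monad C T
  for C :: "('o, 'm) bicart" (structure) and T :: "('o, 'm) smonad" +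
  fixes le :: "'o \<Rightarrow> 'o \<Rightarrow> 'm \<Rightarrow> 'm \<Rightarrow> bool"
  assumes hom_omega_cpo: "omega_cpo (hom C X (omap T Y)) (le X Y)"
    and klift_cont_left: "g \<in> hom C Y (omap T Z) \<Longrightarrow>
      omega_cont (hom C X (omap T Y)) (le X Y) (hom C X (omap T Z)) (le X Z)
        (\<lambda>f. klift C T Z g \<cdot> f)"
    and klift_cont_right: "f \<in> hom C X (omap T Y) \<Longrightarrow>
      omega_cont (hom C Y (omap T Z)) (le Y Z) (hom C X (omap T Z)) (le X Z)
        (\<lambda>g. klift C T Z g \<cdot> f)"
    and mstr_cont:
      "omega_cont (hom C X (omap T Y)) (le X Y)
        (hom C (W \<otimes> X) (omap T (W \<otimes> Y))) (le (W \<otimes> X) (W \<otimes> Y))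
        (\<lambda>f. mstr T W Y \<cdot> (idn C W \<otimes>\<^sub>m f))"
    and copair_cont:
      "\<lbrakk>omega_chain (hom C X (omap T Z)) (le X Z) fs; is_sup (hom C X (omap T Z)) (le X Z) fs s;
        omega_chain (hom C Y (omap T Z)) (le Y Z) gs; is_sup (hom C Y (omap T Z)) (le Y Z) gs t\<rbrakk> \<Longrightarrow>
       is_sup (hom C (X \<oplus> Y) (omap T Z)) (le (X \<oplus> Y) Z) (\<lambda>i. \<lblot>fs i, gs i\<rblot>) \<lblot>s, t\<rblot>"
    and mstr_bot: "is_bot (hom C X (omap T Y)) (le X Y) b \<Longrightarrow>
      is_bot (hom C (W \<otimes> X) (omap T (W \<otimes> Y))) (le (W \<otimes> X) (W \<otimes> Y))
        (mstr T W Y \<cdot> (idn C W \<otimes>\<^sub>m b))"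
    and klift_bot: "\<lbrakk>f \<in> hom C Y (omap T Z); is_bot (hom C X (omap T Y)) (le X Y) b\<rbrakk> \<Longrightarrow>
      is_bot (hom C X (omap T Z)) (le X Z) (klift C T Z f \<cdot> b)"


definition sig_functor :: "('o, 'm) bicart \<Rightarrow> ('o, 'm, 'o, 'm) func \<Rightarrow>
    ('o \<times> 'o, 'm \<times> 'm, 'o, 'm) func \<Rightarrow> ('o, 'm, 'o, 'm) func" where
  "sig_functor C Sv Sc =
     \<lparr>omap = (\<lambda>X. omap Sv X \<oplus>\<^bsub>C\<^esub> omap Sc (X, X)), amap = (\<lambda>f. amap Sv f \<oplus>\<^sub>m\<^bsub>C\<^esub> amap Sc (f, f))\<rparr>"

text \<open>A choice of free algebras on all objects \<open>X\<close>: carrier \<open>fobj F X\<close>, universal arrow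
  \<open>funit F X : X \<rightarrow> fobj F X\<close> and algebra structure \<open>falg F X : S (fobj F X) \<rightarrow> fobj F X\<close>.\<close>

record ('o, 'm) free_algs =
  fobj :: "'o \<Rightarrow> 'o"
  funit :: "'o \<Rightarrow> 'm"
  falg :: "'o \<Rightarrow> 'm"

definition is_free_ext :: "('o, 'm) bicart \<Rightarrow> ('o, 'm, 'o, 'm) func \<Rightarrow> ('o, 'm) free_algs \<Rightarrow>
    'o \<Rightarrow> 'o \<Rightarrow> 'm \<Rightarrow> 'm \<Rightarrow> 'm \<Rightarrow> bool" where
  "is_free_ext C S F X A a f h \<longleftrightarrow> h \<in> hom C (fobj F X) A \<and>
     h \<cdot>\<^bsub>C\<^esub> funit F X = f \<and> h \<cdot>\<^bsub>C\<^esub> falg F X = a \<cdot>\<^bsub>C\<^esub> amap S h"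

definition free_algebras ::
  "('o, 'm) bicart \<Rightarrow> ('o, 'm, 'o, 'm) func \<Rightarrow> ('o, 'm) free_algs \<Rightarrow> bool" where
  "free_algebras C S F \<longleftrightarrow> (\<forall>X.
     funit F X \<in> hom C X (fobj F X) \<and> falg F X \<in> hom C (omap S (fobj F X)) (fobj F X) \<and>
     (\<forall>A. \<forall>a \<in> hom C (omap S A) A. \<forall>f \<in> hom C X A. \<exists>!h. is_free_ext C S F X A a f h))"

definition free_functor :: "('o, 'm) bicart \<Rightarrow> ('o, 'm, 'o, 'm) func \<Rightarrow> ('o, 'm) free_algs \<Rightarrow>
    ('o, 'm, 'o, 'm) func" where
  "free_functor C S F = \<lparr>omap = fobj F,
     amap = (\<lambda>f. THE h. is_free_ext C S F (src C f) (fobj F (tgt C f)) (falg F (tgt C f))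
        (funit F (tgt C f) \<cdot>\<^bsub>C\<^esub> f) h)\<rparr>"

definition free_mult :: "('o, 'm) bicart \<Rightarrow> ('o, 'm, 'o, 'm) func \<Rightarrow> ('o, 'm) free_algs \<Rightarrow>
    'o \<Rightarrow> 'm" where
  "free_mult C S F X =
     (THE h. is_free_ext C S F (fobj F X) (fobj F X) (falg F X) (idn C (fobj F X)) h)"


text \<open>The locale \<open>hogsos\<close> fixes the data without assumptions. \<open>mu\<close> is the initial algebra
  \<open>\<mu>\<Sigma>\<close>, and \<open>V\<close>, \<open>K\<close> are the objects \<open>S\<^sub>v\<close>, \<open>S\<^sub>c\<close> of values and computations. The arrow
  \<open>gamma_c\<close> and the inverse of \<open>iota\<close> are described uniquely once the functors, free algebras and
  the law satisfy their axioms; \<open>le\<close> in the least fixpoints is the order of the monad.\<close>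

locale hogsos =
  fixes C :: "('o, 'm) bicart" (structure)
    and Sv :: "('o, 'm, 'o, 'm) func"
    and Sc :: "('o \<times> 'o, 'm \<times> 'm, 'o, 'm) func"
    and F :: "('o, 'm) free_algs"
    and T :: "('o, 'm) smonad"
    and D :: "('o \<times> 'o, 'm \<times> 'm, 'o, 'm) func"
    and \<rho>v :: "'o \<Rightarrow> 'm"
    and \<rho>c :: "'o \<Rightarrow> 'o \<Rightarrow> 'm"
    and \<chi> :: "'o \<Rightarrow> 'o \<Rightarrow> 'm"
begin

abbreviation "Svo X \<equiv> omap Sv X"
abbreviation "Sva f \<equiv> amap Sv f"
abbreviation "Sco X Y \<equiv> omap Sc (X, Y)"
abbreviation "Sca f g \<equiv> amap Sc (f, g)"
abbreviation "To X \<equiv> omap T X"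
abbreviation "Ta f \<equiv> amap T f"
abbreviation "Do X Y \<equiv> omap D (X, Y)"
abbreviation "Da f g \<equiv> amap D (f, g)"
abbreviation "S \<equiv> sig_functor C Sv Sc"
abbreviation "Fo X \<equiv> fobj F X"
abbreviation "Fa f \<equiv> amap (free_functor C S F) f"
abbreviation "Fmult X \<equiv> free_mult C S F X"

definition B :: "('o \<times> 'o, 'm \<times> 'm, 'o, 'm) func" where
  "B = \<lparr>omap = (\<lambda>(X, Y). To (Do X Y) \<oplus> To Y), amap = (\<lambda>(f, g). Ta (Da f g) \<oplus>\<^sub>m Ta g)\<rparr>"

abbreviation "Bo X Y \<equiv> omap B (X, Y)"
abbreviation "Ba f g \<equiv> amap B (f, g)"

definition iota_v :: "'o \<Rightarrow> 'm" where
  "iota_v X = falg F X \<cdot> cinl C (Svo (Fo X)) (Sco (Fo X) (Fo X))"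

definition iota_c :: "'o \<Rightarrow> 'm" where
  "iota_c X = falg F X \<cdot> cinr C (Svo (Fo X)) (Sco (Fo X) (Fo X))"

definition nabla_sharp :: "'o \<Rightarrow> 'm" where
  "nabla_sharp X = Fmult X \<cdot> Fa \<lblot>idn C (Fo X), idn C (Fo X)\<rblot>"

definition mu :: "'o" where
  "mu = Fo (zero C)"

definition iota :: "'m" where
  "iota = falg F (zero C)"

definition V :: "'o" where
  "V = Svo mu"

definition K :: "'o" where
  "K = Sco mu mu"

definition rho_cv :: "'o \<Rightarrow> 'o \<Rightarrow> 'm" where
  "rho_cv X Y = \<rho>c X Y \<cdot> Sca (idn C X \<otimes>\<^sub>m cinl C (To (Do X Y)) (To Y)) (idn C X)"

definition gamma_v :: "'m" where
  "gamma_v = munit T (Do mu mu) \<cdot> Da (idn C mu) (Fmult (zero C)) \<cdot> \<rho>v mu"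

definition gamma_c :: "'m" where
  "gamma_c = (THE g. g \<in> hom C K (To mu) \<and>
     g \<cdot> Sca iota (idn C mu) =
       Ta (nabla_sharp (zero C)) \<cdot> \<rho>c mu mu \<cdot> Sca \<langle>iota, gamma_v \<oplus>\<^sub>m g\<rangle> (idn C mu))"

definition xi :: "'o \<Rightarrow> 'm" where
  "xi X = Ta (nabla_sharp X) \<cdot> rho_cv (Fo X) (Fo X)
     \<cdot> Sca \<langle>iota_v X,
            munit T (Do (Fo X) (Fo X)) \<cdot> Da (idn C (Fo X)) (Fmult X) \<cdot> \<rho>v (Fo X)\<rangle>
           (idn C (Fo X))
     \<cdot> Sca (Sva (funit F X)) (funit F X)"

definition beta :: "('o \<Rightarrow> 'o \<Rightarrow> 'm \<Rightarrow> 'm \<Rightarrow> bool) \<Rightarrow> 'm" where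
  "beta le = least_fixpoint (hom C K (To V)) (le K V)
     (\<lambda>f. klift C T V \<lblot>munit T V, f\<rblot> \<cdot> Ta (inv_arr C iota) \<cdot> gamma_c)"

definition beta_hat :: "('o \<Rightarrow> 'o \<Rightarrow> 'm \<Rightarrow> 'm \<Rightarrow> bool) \<Rightarrow> 'm" where
  "beta_hat le = \<lblot>munit T V, beta le\<rblot> \<cdot> inv_arr C iota"

definition zeta_hat :: "('o \<Rightarrow> 'o \<Rightarrow> 'm \<Rightarrow> 'm \<Rightarrow> bool) \<Rightarrow> 'm" where
  "zeta_hat le = least_fixpoint (hom C mu (To V)) (le mu V)
     (\<lambda>f. \<lblot>munit T V,
            klift C T V f \<cdot> Ta (Fmult (zero C)) \<cdot> klift C T (Fo mu) (xi mu)
              \<cdot> \<chi> V mu \<cdot> Sca f (idn C mu)\<rblot>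
          \<cdot> inv_arr C iota)"

definition strongly_separated :: "('o \<Rightarrow> 'o \<Rightarrow> 'o \<Rightarrow> 'm) \<Rightarrow> bool" where
  "strongly_separated \<theta> \<longleftrightarrow> (\<forall>X Y.
     let P = X \<otimes> To (Do X Y); Q = X \<otimes> To Y;
         \<delta> = \<lblot>idn C X \<otimes>\<^sub>m cinl C (To (Do X Y)) (To Y), idn C X \<otimes>\<^sub>m cinr C (To (Do X Y)) (To Y)\<rblot>
     in \<rho>c X Y \<cdot> Sca \<delta> (idn C X) \<cdot> \<theta> P Q X =
        Ta (iota_c (X \<oplus> Y) \<cdot> Sca (funit F (X \<oplus> Y)) (funit F (X \<oplus> Y)))
          \<cdot> \<chi> (X \<oplus> Y) (X \<oplus> Y)
          \<cdot> Sca (ksum C T X Y (Ta (pfst C X (Do X Y)) \<cdot> mstr T X (Do X Y)) (psnd C X (To Y)))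
                (cinl C X Y)
          \<cdot> \<theta> P Q X)"

definition chi_omega_continuous :: "('o \<Rightarrow> 'o \<Rightarrow> 'm \<Rightarrow> 'm \<Rightarrow> bool) \<Rightarrow> bool" where
  "chi_omega_continuous le \<longleftrightarrow> (\<forall>X Y Z.
     omega_cont (hom C X (To Y)) (le X Y)
       (hom C (Sco X Z) (To (Sco Y Z))) (le (Sco X Z) (Sco Y Z))
       (\<lambda>f. \<chi> Y Z \<cdot> Sca f (idn C Z)))"

end

locale separated_law = hogsos +
  assumes \<rho>v_hom: "\<rho>v X \<in> hom C (Svo X) (Do X (Fo X))"
    and \<rho>v_dinatural: "f \<in> hom C X X' \<Longrightarrow>
      Da (idn C X) (Fa f) \<cdot> \<rho>v X = Da f (idn C (Fo X')) \<cdot> \<rho>v X' \<cdot> Sva f"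
    and \<rho>c_hom: "\<rho>c X Y \<in> hom C (Sco (X \<otimes> Bo X Y) X) (To (Fo (X \<oplus> Y)))"
    and \<rho>c_dinatural: "f \<in> hom C X X' \<Longrightarrow>
      Ta (Fa (f \<oplus>\<^sub>m idn C Y)) \<cdot> \<rho>c X Y \<cdot> Sca (idn C X \<otimes>\<^sub>m Ba f (idn C Y)) (idn C X) =
      \<rho>c X' Y \<cdot> Sca (f \<otimes>\<^sub>m idn C (Bo X' Y)) f"
    and \<rho>c_natural: "g \<in> hom C Y Y' \<Longrightarrow>
      Ta (Fa (idn C X \<oplus>\<^sub>m g)) \<cdot> \<rho>c X Y =
      \<rho>c X Y' \<cdot> Sca (idn C X \<otimes>\<^sub>m Ba (idn C X) g) (idn C X)"
    and \<chi>_hom: "\<chi> X Y \<in> hom C (Sco (To X) Y) (To (Sco X Y))"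
    and \<chi>_natural: "\<lbrakk>f \<in> hom C X X'; g \<in> hom C Y Y'\<rbrakk> \<Longrightarrow>
      Ta (Sca f g) \<cdot> \<chi> X Y = \<chi> X' Y' \<cdot> Sca (Ta f) g"
    and \<chi>_munit: "\<chi> X Y \<cdot> Sca (munit T X) (idn C Y) = munit T (Sco X Y)"
    and \<chi>_mmult: "\<chi> X Y \<cdot> Sca (mmult T X) (idn C Y) =
      mmult T (Sco X Y) \<cdot> Ta (\<chi> X Y) \<cdot> \<chi> (To X) Y"

locale computation_splitting =
  fixes C :: "('o, 'm) bicart" (structure)
    and Sc :: "('o \<times> 'o, 'm \<times> 'm, 'o, 'm) func"
    and \<Theta> :: "('o \<times> 'o \<times> 'o, 'm \<times> 'm \<times> 'm, 'o, 'm) func"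
    and \<theta> :: "'o \<Rightarrow> 'o \<Rightarrow> 'o \<Rightarrow> 'm"
  assumes functor_\<Theta>: "is_functor (C \<times>\<^sub>C C \<times>\<^sub>C C) C \<Theta>"
    and \<theta>_natural: "\<lbrakk>f \<in> hom C X X'; g \<in> hom C Y Y'; h \<in> hom C Z Z'\<rbrakk> \<Longrightarrow>
      amap Sc (f \<oplus>\<^sub>m g, h) \<cdot> \<theta> X Y Z = \<theta> X' Y' Z' \<cdot> amap \<Theta> (f, g, h)"
    and coproduct: "is_coproduct C (omap Sc (X, Z)) (omap \<Theta> (X, Y, Z)) (omap Sc (X \<oplus> Y, Z))
      (amap Sc (cinl C X Y, idn C Z)) (\<theta> X Y Z)"

end

theory Submission
  imports Defs
begin

text \<open>
  Let \<open>\<kappa> = \<lblot>\<eta> \<cdot> \<iota>\<^sub>v, \<gamma>\<^sub>c\<rblot> \<cdot> \<iota>\<^sup>-\<^sup>1\<close> be the total one-step map, \<open>v = \<gamma>\<^sub>c \<cdot> \<Sigma>\<^sub>c(\<iota>\<^sub>v, id)\<close>, and write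
  \<open>f\<^sup>#\<close> for Kleisli extension. Dinaturality identifies \<open>T \<mu> \<cdot> \<xi>\<close> with \<open>v\<close>, and strong separation says that on
  the summand \<open>\<Theta>\<close> of \<open>S\<^sub>c\<close> the map \<open>\<gamma>\<^sub>c\<close> equals \<open>T \<iota>\<^sub>c \<cdot> \<chi> \<cdot> \<Sigma>\<^sub>c(\<kappa>, id)\<close>.

  If \<open>z\<close> is any fixpoint of the big-step functional, then \<open>z\<close> and \<open>z\<^sup># \<cdot> \<kappa>\<close> satisfy the same structural
  recursion over the initial algebra, hence coincide. So \<open>z \<cdot> \<iota>\<^sub>c\<close> is a fixpoint of the small-step
  functional and \<open>\<beta>\<close> lies below it.

  Conversely \<open>\<beta>\<close> satisfies the big-step equation \<open>\<beta> = A \<beta>\<close> with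
  \<open>A f = (\<beta>\<^sup># \<cdot> v)\<^sup># \<cdot> \<chi> \<cdot> \<Sigma>\<^sub>c(\<lblot>\<eta>, f\<rblot> \<cdot> \<iota>\<^sup>-\<^sup>1, id)\<close> (the \<open>\<beta>\<close> on the right extended by \<open>\<eta>\<close> to values): both
  inequalities follow by fixpoint induction on \<open>\<beta>\<close>, comparing the two sides on the summands
  \<open>\<Sigma>\<^sub>c(S\<^sub>v, \<mu>\<Sigma>)\<close> and \<open>\<Theta>\<close> of \<open>S\<^sub>c\<close>.
\<close>

section \<open>Fixpoints in omega-cpos\<close>

lemma omega_cpo_antisym:
  "\<lbrakk>omega_cpo A le; le x y; le y x; x \<in> A; y \<in> A\<rbrakk> \<Longrightarrow> x = y"
  unfolding omega_cpo_def by (meson antisymp_onD)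

lemma omega_cpo_refl: "\<lbrakk>omega_cpo A le; x \<in> A\<rbrakk> \<Longrightarrow> le x x"
  unfolding omega_cpo_def by (meson reflp_onD)

lemma is_sup_const: "\<lbrakk>omega_cpo A le; x \<in> A\<rbrakk> \<Longrightarrow> is_sup A le (\<lambda>_. x) x"
  unfolding is_sup_def by (auto intro: omega_cpo_refl)

lemma omega_chain_const: "\<lbrakk>omega_cpo A le; x \<in> A\<rbrakk> \<Longrightarrow> omega_chain A le (\<lambda>_. x)"
  unfolding omega_chain_def by (auto intro: omega_cpo_refl)

lemma is_sup_unique:
  "\<lbrakk>omega_cpo A le; is_sup A le f s; is_sup A le f t\<rbrakk> \<Longrightarrow> s = t"
  unfolding is_sup_def by (rule omega_cpo_antisym[of A le]) blast+

text \<open>The test chain x, y, y, ... through which monotonicity is extracted from conditions that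
  only speak of chains and their suprema.\<close>

lemma omega_chain_step:
  assumes "omega_cpo A le" "x \<in> A" "y \<in> A" "le x y"
  shows "omega_chain A le (\<lambda>n. if n = 0 then x else y)"
    and "is_sup A le (\<lambda>n. if n = 0 then x else y) y"
  using assms unfolding omega_chain_def is_sup_def
  by (auto intro: omega_cpo_refl)

text \<open>\<open>omega_cont\<close> does not state outright that \<open>\<Phi>\<close> maps
  \<open>A\<close> into \<open>A'\<close>; membership comes from the constant chain, because a
  supremum lies in its carrier by \<open>is_sup\<close>.\<close>

lemma omega_cont_closed:
  assumes "omega_cont A le A' le' \<Phi>" "omega_cpo A le" "x \<in> A"
  shows "\<Phi> x \<in> A'"
  using assms is_sup_const[of A le x] omega_chain_const[of A le x]
  unfolding omega_cont_def is_sup_def by blast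

lemma omega_cont_mono:
  assumes "omega_cont A le A' le' \<Phi>" "omega_cpo A le" "x \<in> A" "y \<in> A" "le x y"
  shows "le' (\<Phi> x) (\<Phi> y)"
proof -
  have "is_sup A' le' (\<lambda>n. \<Phi> (if n = (0::nat) then x else y)) (\<Phi> y)"
    using assms omega_chain_step[of A le x y] unfolding omega_cont_def by blast
  then have "le' (\<Phi> (if (0::nat) = 0 then x else y)) (\<Phi> y)"
    unfolding is_sup_def by blast
  then show ?thesis by simp
qed

lemma omega_cont_chain:
  assumes "omega_cont A le A' le' \<Phi>" "omega_cpo A le" "omega_chain A le f"
  shows "omega_chain A' le' (\<lambda>i. \<Phi> (f i))"
  using assms omega_cont_closed[OF assms(1,2)] omega_cont_mono[OF assms(1,2)]
  unfolding omega_chain_def by blast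

lemma omega_cont_comp:
  assumes "omega_cont A le A' le' \<Phi>" "omega_cont A' le' A'' le'' \<Psi>" "omega_cpo A le"
  shows "omega_cont A le A'' le'' (\<lambda>x. \<Psi> (\<Phi> x))"
  using assms omega_cont_chain[OF assms(1,3)] unfolding omega_cont_def by blast

text \<open>Antisymmetry makes the description in \<open>least_fixpoint\<close> unique. The Kleene
  construction and the final identification of \<open>zeta_hat\<close> both end with this
  rule.\<close>

lemma least_fixpoint_eqI:
  assumes "omega_cpo A le" "f \<in> A" "\<Phi> f = f" "\<And>g. \<lbrakk>g \<in> A; \<Phi> g = g\<rbrakk> \<Longrightarrow> le f g"
  shows "least_fixpoint A le \<Phi> = f"
  unfolding least_fixpoint_def using assms
  by (intro the_equality) (auto intro: omega_cpo_antisym)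

context
  fixes A :: "'a set" and le :: "'a \<Rightarrow> 'a \<Rightarrow> bool" and \<Phi> :: "'a \<Rightarrow> 'a"
  assumes cpo: "omega_cpo A le" and cont: "omega_cont A le A le \<Phi>"
begin

text \<open>Kleene's construction. All data are exported together, since fixpoint induction needs
  the chain of iterates itself and not only its supremum.\<close>

lemma kleene:
  obtains b s where "is_bot A le b" "omega_chain A le (\<lambda>n. (\<Phi> ^^ n) b)"
    "is_sup A le (\<lambda>n. (\<Phi> ^^ n) b) s" "least_fixpoint A le \<Phi> = s" "\<Phi> s = s"
    "\<And>g. \<lbrakk>g \<in> A; \<Phi> g = g\<rbrakk> \<Longrightarrow> le s g"
proof -
  note closed = omega_cont_closed[OF cont cpo] and mono = omega_cont_mono[OF cont cpo]
  obtain b where b: "is_bot A le b" using cpo unfolding omega_cpo_def by blast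
  have bA: "b \<in> A" and least: "\<And>u. u \<in> A \<Longrightarrow> le b u" using b unfolding is_bot_def by auto
  have it: "(\<Phi> ^^ n) b \<in> A" for n by (induction n) (auto simp: bA closed)
  have "le ((\<Phi> ^^ n) b) ((\<Phi> ^^ Suc n) b)" for n
    by (induction n) (simp_all add: it mono closed least bA)
  then have ch: "omega_chain A le (\<lambda>n. (\<Phi> ^^ n) b)" using it unfolding omega_chain_def by blast
  then obtain s where s: "is_sup A le (\<lambda>n. (\<Phi> ^^ n) b) s" using cpo unfolding omega_cpo_def by blast
  then have sA: "s \<in> A" unfolding is_sup_def by blast
  \<comment> \<open>The shifted chain has supremum \<open>\<Phi> s\<close> by continuity, and
    supremum \<open>s\<close> because dropping the least element \<open>b\<close> does not change
    the upper bounds.\<close>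
  have "is_sup A le (\<lambda>n. (\<Phi> ^^ Suc n) b) (\<Phi> s)"
    using cont ch s unfolding omega_cont_def by auto
  moreover have "is_sup A le (\<lambda>n. (\<Phi> ^^ Suc n) b) s"
    using s least unfolding is_sup_def
    by (metis funpow_0 not0_implies_Suc)
  ultimately have fixed: "\<Phi> s = s" using is_sup_unique[OF cpo] by blast
  have leastfix: "le s g" if g: "g \<in> A" "\<Phi> g = g" for g
  proof -
    have "le ((\<Phi> ^^ n) b) g" for n
    proof (induction n)
      case 0 then show ?case using least g by simp
    next
      case (Suc n) then show ?case using mono[OF it[of n] g(1)] g(2) by simp
    qed
    then show ?thesis using s g unfolding is_sup_def by blast
  qed
  have "least_fixpoint A le \<Phi> = s"
    by (rule least_fixpoint_eqI[where f = s]) (fact cpo sA fixed leastfix)+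
  then show ?thesis using that[OF b ch s _ fixed leastfix] by blast
qed

lemma least_fixpoint_closed: "least_fixpoint A le \<Phi> \<in> A"
  by (rule kleene) (simp add: is_sup_def)

lemma least_fixpoint_unfold: "\<Phi> (least_fixpoint A le \<Phi>) = least_fixpoint A le \<Phi>"
  by (rule kleene) simp

lemma least_fixpoint_least: "\<lbrakk>g \<in> A; \<Phi> g = g\<rbrakk> \<Longrightarrow> le (least_fixpoint A le \<Phi>) g"
  by (rule kleene) simp

text \<open>Scott induction: the property passes along the iterates from bottom and reaches their
  supremum by admissibility.\<close>

lemma fixpoint_induct:
  assumes bot: "\<And>b. is_bot A le b \<Longrightarrow> P b"
    and step: "\<And>f. \<lbrakk>f \<in> A; P f\<rbrakk> \<Longrightarrow> P (\<Phi> f)"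
    and adm: "\<And>f s. \<lbrakk>omega_chain A le f; is_sup A le f s; \<And>i. P (f i)\<rbrakk> \<Longrightarrow> P s"
  shows "P (least_fixpoint A le \<Phi>)"
proof (rule kleene)
  fix b s
  assume b: "is_bot A le b" and ch: "omega_chain A le (\<lambda>n. (\<Phi> ^^ n) b)"
    and s: "is_sup A le (\<lambda>n. (\<Phi> ^^ n) b) s" "least_fixpoint A le \<Phi> = s"
  have "P ((\<Phi> ^^ n) b)" for n
    by (induction n) (use bot[OF b] step ch in \<open>auto simp: omega_chain_def\<close>)
  then show ?thesis using adm[OF ch s(1)] s(2) by blast
qed

end

section \<open>Categories with products and coproducts\<close>

text \<open>Typing is checked by the simplifier, which computes sources and targets; hence the axioms
  are restated with side conditions on \<open>src\<close> and \<open>tgt\<close>.\<close>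

lemma in_hom_iff [simp]: "f \<in> hom C X Y \<longleftrightarrow> f \<in> arrs C \<and> src C f = X \<and> tgt C f = Y"
  by (simp add: hom_def)

context category
begin

lemma idn_arr [simp]: "idn C X \<in> arrs C" "src C (idn C X) = X" "tgt C (idn C X) = X"
  using idn_hom[of X] by auto

lemma cmp_arr [simp]:
  assumes "f \<in> arrs C" "g \<in> arrs C" "tgt C f = src C g"
  shows "g \<cdot> f \<in> arrs C" "src C (g \<cdot> f) = src C f" "tgt C (g \<cdot> f) = tgt C g"
  using cmp_hom[of f "src C f" "tgt C f" g "tgt C g"] assms by auto

lemma cmp_idn [simp]:
  "\<lbrakk>f \<in> arrs C; tgt C f = Y\<rbrakk> \<Longrightarrow> idn C Y \<cdot> f = f"
  "\<lbrakk>f \<in> arrs C; src C f = X\<rbrakk> \<Longrightarrow> f \<cdot> idn C X = f"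
  using cmp_idn_left cmp_idn_right by auto

lemma cmp_assoc' [simp]:
  "\<lbrakk>f \<in> arrs C; g \<in> arrs C; h \<in> arrs C; tgt C f = src C g; tgt C g = src C h\<rbrakk>
    \<Longrightarrow> (h \<cdot> g) \<cdot> f = h \<cdot> (g \<cdot> f)"
  using cmp_assoc by auto

text \<open>Composites are normalised to the right, so an equation for \<open>h \<cdot> g\<close>
  does not match inside a longer composite; this form re-brackets it for use there.\<close>

lemma cmp_eq_assoc:
  "\<lbrakk>h \<cdot> g = k; f \<in> arrs C; g \<in> arrs C; h \<in> arrs C; tgt C f = src C g; tgt C g = src C h\<rbrakk>
    \<Longrightarrow> h \<cdot> (g \<cdot> f) = k \<cdot> f"
  by (metis cmp_assoc')

lemma inv_arr:
  assumes "is_iso C f"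
  shows "inv_arr C f \<in> hom C (tgt C f) (src C f)"
    and "inv_arr C f \<cdot> f = idn C (src C f)" and "f \<cdot> inv_arr C f = idn C (tgt C f)"
proof -
  let ?P = "\<lambda>g. g \<in> hom C (tgt C f) (src C f) \<and> g \<cdot> f = idn C (src C f) \<and> f \<cdot> g = idn C (tgt C f)"
  have f: "f \<in> arrs C" using assms unfolding is_iso_def by blast
  have "g = h" if "?P g" "?P h" for g h
  proof -
    have "g = g \<cdot> (f \<cdot> h)" using that by simp
    also have "\<dots> = (g \<cdot> f) \<cdot> h" using that f cmp_assoc'[of h f g] by simp
    also have "\<dots> = h" using that by simp
    finally show ?thesis .
  qed
  moreover obtain g where "?P g" using assms unfolding is_iso_def by blast
  ultimately have "\<exists>!g. ?P g" by blast
  from theI'[OF this] have "?P (inv_arr C f)" unfolding inv_arr_def .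
  then show "inv_arr C f \<in> hom C (tgt C f) (src C f)"
    "inv_arr C f \<cdot> f = idn C (src C f)" "f \<cdot> inv_arr C f = idn C (tgt C f)"
    by blast+
qed

end

context distributive_category
begin

lemma prd_arr [simp]:
  "pfst C X Y \<in> arrs C" "src C (pfst C X Y) = X \<otimes> Y" "tgt C (pfst C X Y) = X"
  "psnd C X Y \<in> arrs C" "src C (psnd C X Y) = X \<otimes> Y" "tgt C (psnd C X Y) = Y"
  using pfst_hom[of X Y] psnd_hom[of X Y] by auto

lemma cop_arr [simp]:
  "cinl C X Y \<in> arrs C" "src C (cinl C X Y) = X" "tgt C (cinl C X Y) = X \<oplus> Y"
  "cinr C X Y \<in> arrs C" "src C (cinr C X Y) = Y" "tgt C (cinr C X Y) = X \<oplus> Y"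
  using cinl_hom[of X Y] cinr_hom[of Y X] cinr_hom[of X Y] by auto

lemma pair_arr [simp]:
  assumes "f \<in> arrs C" "g \<in> arrs C" "src C f = src C g"
  shows "\<langle>f, g\<rangle> \<in> arrs C" "src C \<langle>f, g\<rangle> = src C g" "tgt C \<langle>f, g\<rangle> = tgt C f \<otimes> tgt C g"
    "\<lbrakk>tgt C f = X; tgt C g = Y\<rbrakk> \<Longrightarrow> pfst C X Y \<cdot> \<langle>f, g\<rangle> = f"
    "\<lbrakk>tgt C f = X; tgt C g = Y\<rbrakk> \<Longrightarrow> psnd C X Y \<cdot> \<langle>f, g\<rangle> = g"
  using pair_hom[of f "src C g" "tgt C f" g "tgt C g"] assms
    pfst_pair[of f "src C g" X g Y] psnd_pair[of f "src C g" X g Y] by auto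

lemma copair_arr [simp]:
  assumes "f \<in> arrs C" "g \<in> arrs C" "tgt C f = tgt C g"
  shows "\<lblot>f, g\<rblot> \<in> arrs C" "src C \<lblot>f, g\<rblot> = src C f \<oplus> src C g" "tgt C \<lblot>f, g\<rblot> = tgt C g"
    "\<lbrakk>src C f = X; src C g = Y\<rbrakk> \<Longrightarrow> \<lblot>f, g\<rblot> \<cdot> cinl C X Y = f"
    "\<lbrakk>src C f = X; src C g = Y\<rbrakk> \<Longrightarrow> \<lblot>f, g\<rblot> \<cdot> cinr C X Y = g"
  using copair_hom[of f "src C f" "tgt C g" g "src C g"] assms
    copair_cinl[of f X "tgt C g" g Y] copair_cinr[of f X "tgt C g" g Y] by auto

lemma copair_inj_cmp [simp]:
  assumes "f \<in> arrs C" "g \<in> arrs C" "tgt C f = tgt C g" "src C f = X" "src C g = Y" "h \<in> arrs C"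
  shows "tgt C h = X \<Longrightarrow> \<lblot>f, g\<rblot> \<cdot> (cinl C X Y \<cdot> h) = f \<cdot> h"
    "tgt C h = Y \<Longrightarrow> \<lblot>f, g\<rblot> \<cdot> (cinr C X Y \<cdot> h) = g \<cdot> h"
  using assms by (simp_all flip: cmp_assoc')

lemma pair_eqI:
  assumes "h \<in> hom C Z (X \<otimes> Y)" "k \<in> hom C Z (X \<otimes> Y)"
    "pfst C X Y \<cdot> h = pfst C X Y \<cdot> k" "psnd C X Y \<cdot> h = psnd C X Y \<cdot> k"
  shows "h = k"
  by (metis pair_unique[OF assms(1)] pair_unique[OF assms(2)] assms(3,4))

lemma copair_eqI:
  assumes "h \<in> hom C (X \<oplus> Y) Z" "k \<in> hom C (X \<oplus> Y) Z"
    "h \<cdot> cinl C X Y = k \<cdot> cinl C X Y" "h \<cdot> cinr C X Y = k \<cdot> cinr C X Y"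
  shows "h = k"
  by (metis copair_unique[OF assms(1)] copair_unique[OF assms(2)] assms(3,4))

lemma pair_cmp:
  assumes "f \<in> arrs C" "g \<in> arrs C" "src C f = src C g" "h \<in> arrs C" "tgt C h = src C g"
  shows "\<langle>f, g\<rangle> \<cdot> h = \<langle>f \<cdot> h, g \<cdot> h\<rangle>"
  by (rule pair_eqI[of _ "src C h" "tgt C f" "tgt C g"])
     (use assms in \<open>simp_all flip: cmp_assoc'\<close>)

lemma cmp_copair:
  assumes "f \<in> arrs C" "g \<in> arrs C" "tgt C f = tgt C g" "h \<in> arrs C" "tgt C g = src C h"
  shows "h \<cdot> \<lblot>f, g\<rblot> = \<lblot>h \<cdot> f, h \<cdot> g\<rblot>"
  by (rule copair_eqI[of _ "src C f" "src C g" "tgt C h"]) (use assms in simp_all)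

lemma pmap_arr [simp]:
  assumes "f \<in> arrs C" "g \<in> arrs C"
  shows "f \<otimes>\<^sub>m g \<in> arrs C" "src C (f \<otimes>\<^sub>m g) = src C f \<otimes> src C g"
    "tgt C (f \<otimes>\<^sub>m g) = tgt C f \<otimes> tgt C g"
  using assms by (simp_all add: pmap_def)

lemma pmap_pair:
  assumes "f \<in> arrs C" "g \<in> arrs C" "h \<in> arrs C" "k \<in> arrs C"
    "src C h = src C k" "tgt C h = src C f" "tgt C k = src C g"
  shows "(f \<otimes>\<^sub>m g) \<cdot> \<langle>h, k\<rangle> = \<langle>f \<cdot> h, g \<cdot> k\<rangle>"
  using assms by (simp add: pmap_def pair_cmp)

lemma cmap_arr [simp]:
  assumes "f \<in> arrs C" "g \<in> arrs C"
  shows "f \<oplus>\<^sub>m g \<in> arrs C" "src C (f \<oplus>\<^sub>m g) = src C f \<oplus> src C g"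
    "tgt C (f \<oplus>\<^sub>m g) = tgt C f \<oplus> tgt C g"
  using assms by (simp_all add: cmap_def)

lemma cmap_inj [simp]:
  assumes "f \<in> arrs C" "g \<in> arrs C" "src C f = X" "src C g = Y"
  shows "(f \<oplus>\<^sub>m g) \<cdot> cinl C X Y = cinl C (tgt C f) (tgt C g) \<cdot> f"
    "(f \<oplus>\<^sub>m g) \<cdot> cinr C X Y = cinr C (tgt C f) (tgt C g) \<cdot> g"
    "\<lbrakk>h \<in> arrs C; tgt C h = X\<rbrakk> \<Longrightarrow>
      (f \<oplus>\<^sub>m g) \<cdot> (cinl C X Y \<cdot> h) = cinl C (tgt C f) (tgt C g) \<cdot> (f \<cdot> h)"
    "\<lbrakk>h \<in> arrs C; tgt C h = Y\<rbrakk> \<Longrightarrow>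
      (f \<oplus>\<^sub>m g) \<cdot> (cinr C X Y \<cdot> h) = cinr C (tgt C f) (tgt C g) \<cdot> (g \<cdot> h)"
  using assms by (simp_all add: cmap_def)

lemma copair_cmap:
  assumes "f \<in> arrs C" "g \<in> arrs C" "h \<in> arrs C" "k \<in> arrs C"
    "tgt C h = tgt C k" "tgt C f = src C h" "tgt C g = src C k"
  shows "\<lblot>h, k\<rblot> \<cdot> (f \<oplus>\<^sub>m g) = \<lblot>h \<cdot> f, k \<cdot> g\<rblot>"
  by (rule copair_eqI[of _ "src C f" "src C g" "tgt C k"]) (use assms in simp_all)

lemma cmap_cmap:
  assumes "f \<in> arrs C" "g \<in> arrs C" "h \<in> arrs C" "k \<in> arrs C"
    "tgt C f = src C h" "tgt C g = src C k"
  shows "(h \<oplus>\<^sub>m k) \<cdot> (f \<oplus>\<^sub>m g) = (h \<cdot> f) \<oplus>\<^sub>m (k \<cdot> g)"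
  by (rule copair_eqI[of _ "src C f" "src C g" "tgt C h \<oplus> tgt C k"]) (use assms in simp_all)

lemma cmap_idn: "idn C X \<oplus>\<^sub>m idn C Y = idn C (X \<oplus> Y)"
  by (rule copair_eqI[of _ X Y "X \<oplus> Y"]) simp_all

text \<open>The injections of any coproduct are jointly epic. This is wanted for the splitting by
  \<open>\<theta>\<close>, which is not one of the chosen coproducts.\<close>

lemma coproduct_eqI:
  assumes "is_coproduct C X Y P i j" "f \<in> hom C P Z" "g \<in> hom C P Z" "f \<cdot> i = g \<cdot> i" "f \<cdot> j = g \<cdot> j"
  shows "f = g"
proof -
  have "i \<in> hom C X P" "j \<in> hom C Y P" using assms(1) unfolding is_coproduct_def by blast+
  then have "f \<cdot> i \<in> hom C X Z" "f \<cdot> j \<in> hom C Y Z"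
    using assms(2) by simp_all
  then have "\<exists>!h. h \<in> hom C P Z \<and> h \<cdot> i = f \<cdot> i \<and> h \<cdot> j = f \<cdot> j"
    using assms(1) unfolding is_coproduct_def by blast
  then show ?thesis using assms(2-5) by metis
qed

end

section \<open>Kleisli calculus\<close>

locale distributive_monad = distributive_category C + omega_continuous_monad C T le
  for C :: "('o, 'm) bicart" (structure) and T :: "('o, 'm) smonad" and le
begin

abbreviation "Tob X \<equiv> omap T X"
abbreviation "Tar f \<equiv> amap T f"

lemma Ta_arr [simp]:
  assumes "f \<in> arrs C"
  shows "Tar f \<in> arrs C" "src C (Tar f) = Tob (src C f)" "tgt C (Tar f) = Tob (tgt C f)"
proof -
  have "Tar f \<in> hom C (Tob (src C f)) (Tob (tgt C f))"
    using functor_T assms unfolding is_functor_def by (blast intro: in_hom_iff[THEN iffD2])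
  then show "Tar f \<in> arrs C" "src C (Tar f) = Tob (src C f)" "tgt C (Tar f) = Tob (tgt C f)" by auto
qed

lemma Ta_idn [simp]: "Tar (idn C X) = idn C (Tob X)"
  using functor_T unfolding is_functor_def by blast

lemma Ta_cmp:
  assumes "f \<in> arrs C" "g \<in> arrs C" "tgt C f = src C g"
  shows "Tar (g \<cdot> f) = Tar g \<cdot> Tar f"
proof -
  have "f \<in> hom C (src C f) (tgt C f)" "g \<in> hom C (tgt C f) (tgt C g)" using assms by simp_all
  then show ?thesis using functor_T unfolding is_functor_def by blast
qed

lemma monad_arr [simp]:
  "munit T X \<in> arrs C" "src C (munit T X) = X" "tgt C (munit T X) = Tob X"
  "mmult T X \<in> arrs C" "src C (mmult T X) = Tob (Tob X)" "tgt C (mmult T X) = Tob X"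
  "mstr T X Y \<in> arrs C" "src C (mstr T X Y) = X \<otimes> Tob Y" "tgt C (mstr T X Y) = Tob (X \<otimes> Y)"
  using munit_hom[of X] mmult_hom[of X] mstr_hom[of X Y] by auto

lemma Ta_munit:
  "\<lbrakk>f \<in> arrs C; src C f = X\<rbrakk> \<Longrightarrow> Tar f \<cdot> munit T X = munit T (tgt C f) \<cdot> f"
  using munit_natural[of f X "tgt C f"] by simp

lemma Ta_munit_cmp:
  assumes "f \<in> arrs C" "src C f = X" "h \<in> arrs C" "tgt C h = X"
  shows "Tar f \<cdot> (munit T X \<cdot> h) = munit T (tgt C f) \<cdot> (f \<cdot> h)"
  using assms Ta_munit[of f X] by (simp flip: cmp_assoc')

abbreviation kl where "kl Z f \<equiv> klift C T Z f"

lemma kl_arr [simp]: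
  assumes "f \<in> arrs C" "tgt C f = Tob Z"
  shows "kl Z f \<in> arrs C" "src C (kl Z f) = Tob (src C f)" "tgt C (kl Z f) = Tob Z"
  using assms by (simp_all add: klift_def)

lemma kl_munit [simp]: "kl Z (munit T Z) = idn C (Tob Z)"
  by (simp add: klift_def mmult_map_munit)

lemma kl_cmp_munit [simp]:
  assumes "f \<in> arrs C" "tgt C f = Tob Z" "src C f = X"
  shows "kl Z f \<cdot> munit T X = f"
    and "\<lbrakk>h \<in> arrs C; tgt C h = X\<rbrakk> \<Longrightarrow> kl Z f \<cdot> (munit T X \<cdot> h) = f \<cdot> h"
proof -
  show *: "kl Z f \<cdot> munit T X = f"
    using assms Ta_munit[of f X] cmp_eq_assoc[OF mmult_munit, of f Z] by (simp add: klift_def)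
  show "kl Z f \<cdot> (munit T X \<cdot> h) = f \<cdot> h" if "h \<in> arrs C" "tgt C h = X"
    using that assms * cmp_assoc'[of h "munit T X" "kl Z f"] by simp
qed

lemma kl_Ta:
  assumes "f \<in> arrs C" "tgt C f = Tob Z" "g \<in> arrs C" "tgt C g = src C f"
  shows "kl Z f \<cdot> Tar g = kl Z (f \<cdot> g)"
  using assms by (simp add: klift_def Ta_cmp)

lemma Ta_eq_kl:
  assumes "f \<in> arrs C"
  shows "Tar f = kl (tgt C f) (munit T (tgt C f) \<cdot> f)"
  using assms kl_Ta[of "munit T (tgt C f)" "tgt C f" f] by simp

lemma kl_kl:
  assumes "f \<in> arrs C" "tgt C f = Tob Z" "g \<in> arrs C" "tgt C g = Tob (src C f)" "src C f = Y"
  shows "kl Z f \<cdot> kl Y g = kl Z (kl Z f \<cdot> g)"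
proof -
  have "kl Z f \<cdot> kl Y g = mmult T Z \<cdot> (Tar f \<cdot> mmult T Y) \<cdot> Tar g"
    using assms by (simp add: klift_def)
  also have "\<dots> = (mmult T Z \<cdot> mmult T (Tob Z)) \<cdot> Tar (Tar f) \<cdot> Tar g"
    using assms mmult_natural[of f Y "Tob Z"] by simp
  also have "\<dots> = kl Z (kl Z f \<cdot> g)"
    using assms by (simp add: mmult_mmult klift_def Ta_cmp)
  finally show ?thesis .
qed

lemma Ta_kl:
  assumes "f \<in> arrs C" "g \<in> arrs C" "tgt C g = Tob (src C f)" "src C f = Y" "tgt C f = Z"
  shows "Tar f \<cdot> kl Y g = kl Z (Tar f \<cdot> g)"
  using assms Ta_eq_kl[of f] kl_kl[of "munit T Z \<cdot> f" Z g Y] by simp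

section \<open>The order on Kleisli hom-sets\<close>

lemma le_refl: "f \<in> hom C X (Tob Y) \<Longrightarrow> le X Y f f"
  using omega_cpo_refl[OF hom_omega_cpo] .

lemma le_antisym:
  "\<lbrakk>le X Y f g; le X Y g f; f \<in> hom C X (Tob Y); g \<in> hom C X (Tob Y)\<rbrakk> \<Longrightarrow> f = g"
  using omega_cpo_antisym[OF hom_omega_cpo] .

lemma le_kl_right:
  "\<lbrakk>le X Y f f'; f \<in> hom C X (Tob Y); f' \<in> hom C X (Tob Y); g \<in> hom C Y (Tob Z)\<rbrakk>
    \<Longrightarrow> le X Z (kl Z g \<cdot> f) (kl Z g \<cdot> f')"
  using omega_cont_mono[OF klift_cont_left hom_omega_cpo] .

lemma le_kl_left:
  "\<lbrakk>le Y Z g g'; g \<in> hom C Y (Tob Z); g' \<in> hom C Y (Tob Z); f \<in> hom C X (Tob Y)\<rbrakk>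
    \<Longrightarrow> le X Z (kl Z g \<cdot> f) (kl Z g' \<cdot> f)"
  using omega_cont_mono[OF klift_cont_right hom_omega_cpo] .

text \<open>Ordinary precomposition with \<open>f\<close> is Kleisli composition with the pure arrow
  \<open>munit T Y \<cdot> f\<close>, and so inherits its order properties.\<close>

lemma le_precomp:
  assumes "le Y Z g g'" "g \<in> hom C Y (Tob Z)" "g' \<in> hom C Y (Tob Z)" "f \<in> hom C X Y"
  shows "le X Z (g \<cdot> f) (g' \<cdot> f)"
  using le_kl_left[OF assms(1-3), of "munit T Y \<cdot> f" X] assms(2-4) by simp

lemma precomp_cont:
  assumes "f \<in> hom C X Y"
  shows "omega_cont (hom C Y (Tob Z)) (le Y Z) (hom C X (Tob Z)) (le X Z) (\<lambda>g. g \<cdot> f)"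
proof -
  have "omega_cont (hom C Y (Tob Z)) (le Y Z) (hom C X (Tob Z)) (le X Z)
      (\<lambda>g. kl Z g \<cdot> (munit T Y \<cdot> f))"
    using assms by (intro klift_cont_right) simp
  moreover have "kl Z g \<cdot> (munit T Y \<cdot> f) = g \<cdot> f" if "g \<in> hom C Y (Tob Z)" for g
    using assms that by simp
  \<comment> \<open>The two maps agree only on the hom-set, which is where chains and suprema lie by
    definition.\<close>
  ultimately show ?thesis
    unfolding omega_cont_def omega_chain_def is_sup_def by (simp del: in_hom_iff)
qed

lemma copair_right_cont:
  assumes "f \<in> hom C X (Tob Z)"
  shows "omega_cont (hom C Y (Tob Z)) (le Y Z) (hom C (X \<oplus> Y) (Tob Z)) (le (X \<oplus> Y) Z)
    (\<lambda>g. \<lblot>f, g\<rblot>)"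
  unfolding omega_cont_def
  using copair_cont[OF omega_chain_const[OF hom_omega_cpo assms] is_sup_const[OF hom_omega_cpo assms]]
  by blast

lemma le_copair_right:
  "\<lbrakk>le Y Z g g'; f \<in> hom C X (Tob Z); g \<in> hom C Y (Tob Z); g' \<in> hom C Y (Tob Z)\<rbrakk>
    \<Longrightarrow> le (X \<oplus> Y) Z \<lblot>f, g\<rblot> \<lblot>f, g'\<rblot>"
  using omega_cont_mono[OF copair_right_cont hom_omega_cpo] .

text \<open>Joint continuity of copairing is applied to two chains that move from the smaller to the
  larger arrow at the same index.\<close>

lemma le_copair:
  assumes "le X Z f f'" "le Y Z g g'" "f \<in> hom C X (Tob Z)" "f' \<in> hom C X (Tob Z)"
    "g \<in> hom C Y (Tob Z)" "g' \<in> hom C Y (Tob Z)"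
  shows "le (X \<oplus> Y) Z \<lblot>f, g\<rblot> \<lblot>f', g'\<rblot>"
proof -
  let ?s = "\<lambda>x y n. if n = (0::nat) then x else y"
  have "is_sup (hom C (X \<oplus> Y) (Tob Z)) (le (X \<oplus> Y) Z) (\<lambda>n. \<lblot>?s f f' n, ?s g g' n\<rblot>) \<lblot>f', g'\<rblot>"
    using assms by (intro copair_cont omega_chain_step hom_omega_cpo)
  then have "le (X \<oplus> Y) Z \<lblot>?s f f' 0, ?s g g' 0\<rblot> \<lblot>f', g'\<rblot>" unfolding is_sup_def by blast
  then show ?thesis by simp
qed

text \<open>Copairing is monotone for the chosen coproducts. The comparison arrow \<open>h\<close>
  from \<open>P\<close> to \<open>X \<oplus> Y\<close> carries this over to an arbitrary coproduct,
  as every \<open>k\<close> out of \<open>P\<close> is the copairing of its components after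
  \<open>h\<close>.\<close>

lemma le_coproductI:
  assumes cop: "is_coproduct C X Y P i j" and f: "f \<in> hom C P (Tob Z)" and g: "g \<in> hom C P (Tob Z)"
    and "le X Z (f \<cdot> i) (g \<cdot> i)" "le Y Z (f \<cdot> j) (g \<cdot> j)"
  shows "le P Z f g"
proof -
  have i: "i \<in> hom C X P" and j: "j \<in> hom C Y P" using cop unfolding is_coproduct_def by auto
  obtain h where h: "h \<in> hom C P (X \<oplus> Y)" "h \<cdot> i = cinl C X Y" "h \<cdot> j = cinr C X Y"
    using cop cinl_hom[of X Y] cinr_hom[of Y X] unfolding is_coproduct_def by (meson cinr_hom)
  have split: "\<lblot>k \<cdot> i, k \<cdot> j\<rblot> \<cdot> h = k" if "k \<in> hom C P (Tob Z)" for k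
    by (rule coproduct_eqI[OF cop, of _ "Tob Z"]) (use that h i j in simp_all)
  have "le P Z (\<lblot>f \<cdot> i, f \<cdot> j\<rblot> \<cdot> h) (\<lblot>g \<cdot> i, g \<cdot> j\<rblot> \<cdot> h)"
    using assms i j h by (intro le_precomp[OF le_copair]) simp_all
  then show ?thesis using split f g by simp
qed

end

section \<open>Free algebras and primitive recursion\<close>

locale hogsos_syntax = distributive_category C + hogsos C Sv Sc F T D \<rho>v \<rho>c \<chi>
  for C :: "('o, 'm) bicart" (structure)
    and Sv :: "('o, 'm, 'o, 'm) func"
    and Sc :: "('o \<times> 'o, 'm \<times> 'm, 'o, 'm) func"
    and F :: "('o, 'm) free_algs"
    and T :: "('o, 'm) smonad"
    and D :: "('o \<times> 'o, 'm \<times> 'm, 'o, 'm) func"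
    and \<rho>v :: "'o \<Rightarrow> 'm"
    and \<rho>c :: "'o \<Rightarrow> 'o \<Rightarrow> 'm"
    and \<chi> :: "'o \<Rightarrow> 'o \<Rightarrow> 'm" +
  assumes functor_Sv: "is_functor C C Sv"
    and functor_Sc: "is_functor (C \<times>\<^sub>C C) C Sc"
    and functor_D: "is_functor (op_cat C \<times>\<^sub>C C) C D"
    and free: "free_algebras C S F"
begin

lemma Sva_arr [simp]:
  assumes "f \<in> arrs C"
  shows "Sva f \<in> arrs C" "src C (Sva f) = Svo (src C f)" "tgt C (Sva f) = Svo (tgt C f)"
proof -
  have "Sva f \<in> hom C (Svo (src C f)) (Svo (tgt C f))"
    using functor_Sv assms unfolding is_functor_def by (blast intro: in_hom_iff[THEN iffD2])
  then show "Sva f \<in> arrs C" "src C (Sva f) = Svo (src C f)" "tgt C (Sva f) = Svo (tgt C f)"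
    by auto
qed

lemma Sva_idn [simp]: "Sva (idn C X) = idn C (Svo X)"
  using functor_Sv unfolding is_functor_def by blast

lemma Sva_Sva:
  assumes "f \<in> arrs C" "g \<in> arrs C" "tgt C f = src C g"
  shows "Sva g \<cdot> Sva f = Sva (g \<cdot> f)"
proof -
  have "f \<in> hom C (src C f) (tgt C f)" "g \<in> hom C (tgt C f) (tgt C g)" using assms by simp_all
  then show ?thesis using functor_Sv unfolding is_functor_def by (metis (no_types))
qed

lemma Sca_arr [simp]:
  assumes "f \<in> arrs C" "g \<in> arrs C"
  shows "Sca f g \<in> arrs C" "src C (Sca f g) = Sco (src C f) (src C g)"
    "tgt C (Sca f g) = Sco (tgt C f) (tgt C g)"
proof -
  have "(f, g) \<in> hom (C \<times>\<^sub>C C) (src C f, src C g) (tgt C f, tgt C g)"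
    using assms by (simp add: prod_cat_def)
  then have "Sca f g \<in> hom C (Sco (src C f) (src C g)) (Sco (tgt C f) (tgt C g))"
    using functor_Sc unfolding is_functor_def by blast
  then show "Sca f g \<in> arrs C" "src C (Sca f g) = Sco (src C f) (src C g)"
    "tgt C (Sca f g) = Sco (tgt C f) (tgt C g)" by auto
qed

lemma Sca_idn [simp]: "Sca (idn C X) (idn C Y) = idn C (Sco X Y)"
proof -
  have "idn (C \<times>\<^sub>C C) (X, Y) = (idn C X, idn C Y)" by (simp add: prod_cat_def)
  then show ?thesis using functor_Sc unfolding is_functor_def by metis
qed

lemma Sca_Sca:
  assumes "f \<in> arrs C" "g \<in> arrs C" "f' \<in> arrs C" "g' \<in> arrs C"
    "tgt C f = src C f'" "tgt C g = src C g'"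
  shows "Sca f' g' \<cdot> Sca f g = Sca (f' \<cdot> f) (g' \<cdot> g)"
    and "\<lbrakk>h \<in> arrs C; tgt C h = Sco (src C f) (src C g)\<rbrakk>
      \<Longrightarrow> Sca f' g' \<cdot> (Sca f g \<cdot> h) = Sca (f' \<cdot> f) (g' \<cdot> g) \<cdot> h"
proof -
  have "(f, g) \<in> hom (C \<times>\<^sub>C C) (src C f, src C g) (src C f', src C g')"
    "(f', g') \<in> hom (C \<times>\<^sub>C C) (src C f', src C g') (tgt C f', tgt C g')"
    using assms by (simp_all add: prod_cat_def)
  then have "amap Sc ((f', g') \<cdot>\<^bsub>C \<times>\<^sub>C C\<^esub> (f, g)) = Sca f' g' \<cdot> Sca f g"
    using functor_Sc unfolding is_functor_def by blast
  then show *: "Sca f' g' \<cdot> Sca f g = Sca (f' \<cdot> f) (g' \<cdot> g)" by (simp add: prod_cat_def)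
  show "Sca f' g' \<cdot> (Sca f g \<cdot> h) = Sca (f' \<cdot> f) (g' \<cdot> g) \<cdot> h"
    if "h \<in> arrs C" "tgt C h = Sco (src C f) (src C g)"
    by (rule cmp_eq_assoc[OF *]) (use that assms in simp_all)
qed

lemma Da_arr [simp]:
  assumes "f \<in> arrs C" "g \<in> arrs C"
  shows "Da f g \<in> arrs C" "src C (Da f g) = Do (tgt C f) (src C g)"
    "tgt C (Da f g) = Do (src C f) (tgt C g)"
proof -
  have "(f, g) \<in> hom (op_cat C \<times>\<^sub>C C) (tgt C f, src C g) (src C f, tgt C g)"
    using assms by (simp add: prod_cat_def op_cat_def)
  then have "Da f g \<in> hom C (Do (tgt C f) (src C g)) (Do (src C f) (tgt C g))"
    using functor_D unfolding is_functor_def by blast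
  then show "Da f g \<in> arrs C" "src C (Da f g) = Do (tgt C f) (src C g)"
    "tgt C (Da f g) = Do (src C f) (tgt C g)" by auto
qed

lemma Da_Da:
  assumes "f \<in> arrs C" "g \<in> arrs C" "f' \<in> arrs C" "g' \<in> arrs C"
    "tgt C f' = src C f" "tgt C g = src C g'"
  shows "Da f' g' \<cdot> Da f g = Da (f \<cdot> f') (g' \<cdot> g)"
    and "\<lbrakk>h \<in> arrs C; tgt C h = Do (tgt C f) (src C g)\<rbrakk>
      \<Longrightarrow> Da f' g' \<cdot> (Da f g \<cdot> h) = Da (f \<cdot> f') (g' \<cdot> g) \<cdot> h"
proof -
  have "(f, g) \<in> hom (op_cat C \<times>\<^sub>C C) (tgt C f, src C g) (tgt C f', src C g')"
    "(f', g') \<in> hom (op_cat C \<times>\<^sub>C C) (tgt C f', src C g') (src C f', tgt C g')"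
    using assms by (simp_all add: prod_cat_def op_cat_def)
  then have "amap D ((f', g') \<cdot>\<^bsub>op_cat C \<times>\<^sub>C C\<^esub> (f, g)) = Da f' g' \<cdot> Da f g"
    using functor_D unfolding is_functor_def by blast
  then show *: "Da f' g' \<cdot> Da f g = Da (f \<cdot> f') (g' \<cdot> g)" by (simp add: prod_cat_def op_cat_def)
  show "Da f' g' \<cdot> (Da f g \<cdot> h) = Da (f \<cdot> f') (g' \<cdot> g) \<cdot> h"
    if "h \<in> arrs C" "tgt C h = Do (tgt C f) (src C g)"
    by (rule cmp_eq_assoc[OF *]) (use that assms in simp_all)
qed

lemma S_simps: "omap S X = Svo X \<oplus> Sco X X" "amap S f = Sva f \<oplus>\<^sub>m Sca f f"
  by (simp_all add: sig_functor_def)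

lemma S_arr [simp]:
  assumes "f \<in> arrs C"
  shows "amap S f \<in> arrs C" "src C (amap S f) = omap S (src C f)"
    "tgt C (amap S f) = omap S (tgt C f)"
  using assms by (simp_all add: S_simps)

lemma S_S:
  assumes "f \<in> arrs C" "g \<in> arrs C" "tgt C f = src C g"
  shows "amap S g \<cdot> amap S f = amap S (g \<cdot> f)"
  using assms by (simp add: S_simps cmap_cmap Sva_Sva Sca_Sca)

lemma S_idn: "amap S (idn C X) = idn C (omap S X)"
  by (simp add: S_simps cmap_idn)

section \<open>The free monad and its laws\<close>

lemma free_arr [simp]:
  "funit F X \<in> arrs C" "src C (funit F X) = X" "tgt C (funit F X) = Fo X"
  "falg F X \<in> arrs C" "src C (falg F X) = omap S (Fo X)" "tgt C (falg F X) = Fo X"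
  using free unfolding free_algebras_def by auto

lemma free_ext_ex1:
  "\<lbrakk>a \<in> hom C (omap S A) A; f \<in> hom C X A\<rbrakk> \<Longrightarrow> \<exists>!h. is_free_ext C S F X A a f h"
  using free unfolding free_algebras_def by blast

lemma free_eqI:
  assumes "a \<in> hom C (omap S A) A" "h \<in> hom C (Fo X) A" "k \<in> hom C (Fo X) A"
    "h \<cdot> funit F X = k \<cdot> funit F X"
    "h \<cdot> falg F X = a \<cdot> amap S h" "k \<cdot> falg F X = a \<cdot> amap S k"
  shows "h = k"
proof -
  have "\<exists>!h'. is_free_ext C S F X A a (h \<cdot> funit F X) h'"
    using assms(1,2) by (intro free_ext_ex1) simp_all
  moreover have "is_free_ext C S F X A a (h \<cdot> funit F X) h" "is_free_ext C S F X A a (h \<cdot> funit F X) k"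
    using assms(2-6) unfolding is_free_ext_def by metis+
  ultimately show ?thesis by blast
qed

lemma Fa_ext:
  assumes "f \<in> arrs C"
  shows "is_free_ext C S F (src C f) (Fo (tgt C f)) (falg F (tgt C f)) (funit F (tgt C f) \<cdot> f) (Fa f)"
proof -
  have "\<exists>!h. is_free_ext C S F (src C f) (Fo (tgt C f)) (falg F (tgt C f)) (funit F (tgt C f) \<cdot> f) h"
    using assms by (intro free_ext_ex1) simp_all
  from theI'[OF this] show ?thesis by (simp add: free_functor_def)
qed

lemma Fa_arr [simp]:
  assumes "f \<in> arrs C"
  shows "Fa f \<in> arrs C" "src C (Fa f) = Fo (src C f)" "tgt C (Fa f) = Fo (tgt C f)"
  using Fa_ext[OF assms] unfolding is_free_ext_def by auto

lemma Fa_funit: "\<lbrakk>f \<in> arrs C; src C f = X\<rbrakk> \<Longrightarrow> Fa f \<cdot> funit F X = funit F (tgt C f) \<cdot> f"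
  and Fa_falg: "\<lbrakk>f \<in> arrs C; src C f = X\<rbrakk> \<Longrightarrow> Fa f \<cdot> falg F X = falg F (tgt C f) \<cdot> amap S (Fa f)"
  using Fa_ext[of f] unfolding is_free_ext_def by auto

lemma Fmult_ext: "is_free_ext C S F (Fo X) (Fo X) (falg F X) (idn C (Fo X)) (Fmult X)"
proof -
  have "\<exists>!h. is_free_ext C S F (Fo X) (Fo X) (falg F X) (idn C (Fo X)) h"
    by (intro free_ext_ex1) simp_all
  from theI'[OF this] show ?thesis by (simp add: free_mult_def)
qed

lemma Fmult_arr [simp]:
  "Fmult X \<in> arrs C" "src C (Fmult X) = Fo (Fo X)" "tgt C (Fmult X) = Fo X"
  using Fmult_ext[of X] unfolding is_free_ext_def by auto

lemma Fmult_funit: "Fmult X \<cdot> funit F (Fo X) = idn C (Fo X)"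
  and Fmult_falg: "Fmult X \<cdot> falg F (Fo X) = falg F X \<cdot> amap S (Fmult X)"
  using Fmult_ext[of X] unfolding is_free_ext_def by auto

lemma Fa_Fa:
  assumes "f \<in> arrs C" "g \<in> arrs C" "tgt C f = src C g"
  shows "Fa g \<cdot> Fa f = Fa (g \<cdot> f)"
proof (rule free_eqI[where X = "src C f" and A = "Fo (tgt C g)" and a = "falg F (tgt C g)"])
  show "(Fa g \<cdot> Fa f) \<cdot> funit F (src C f) = Fa (g \<cdot> f) \<cdot> funit F (src C f)"
    using assms cmp_eq_assoc[OF Fa_funit, of g "src C g" f] by (simp add: Fa_funit)
  show "(Fa g \<cdot> Fa f) \<cdot> falg F (src C f) = falg F (tgt C g) \<cdot> amap S (Fa g \<cdot> Fa f)"
    using assms cmp_eq_assoc[OF Fa_falg, of g "src C g" "amap S (Fa f)"]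
    by (simp add: Fa_falg flip: S_S)
qed (use assms in \<open>simp_all add: Fa_falg\<close>)

text \<open>Associativity of the free monad: both sides are algebra morphisms that restrict to
  \<open>Fmult X\<close> on generators.\<close>

lemma Fmult_Fmult: "Fmult X \<cdot> Fa (Fmult X) = Fmult X \<cdot> Fmult (Fo X)"
proof (rule free_eqI[where X = "Fo (Fo X)" and A = "Fo X" and a = "falg F X"])
  show "(Fmult X \<cdot> Fa (Fmult X)) \<cdot> funit F (Fo (Fo X)) = (Fmult X \<cdot> Fmult (Fo X)) \<cdot> funit F (Fo (Fo X))"
    using cmp_eq_assoc[OF Fmult_funit, of "Fmult X" X] by (simp add: Fa_funit Fmult_funit)
  show "(Fmult X \<cdot> Fa (Fmult X)) \<cdot> falg F (Fo (Fo X)) = falg F X \<cdot> amap S (Fmult X \<cdot> Fa (Fmult X))"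
    using cmp_eq_assoc[OF Fmult_falg, of "amap S (Fa (Fmult X))" X] by (simp add: Fa_falg flip: S_S)
  show "(Fmult X \<cdot> Fmult (Fo X)) \<cdot> falg F (Fo (Fo X)) = falg F X \<cdot> amap S (Fmult X \<cdot> Fmult (Fo X))"
    using cmp_eq_assoc[OF Fmult_falg, of "amap S (Fmult (Fo X))" X] by (simp add: Fmult_falg flip: S_S)
qed simp_all

lemma iota_vc_arr [simp]:
  "iota_v X \<in> arrs C" "src C (iota_v X) = Svo (Fo X)" "tgt C (iota_v X) = Fo X"
  "iota_c X \<in> arrs C" "src C (iota_c X) = Sco (Fo X) (Fo X)" "tgt C (iota_c X) = Fo X"
  by (simp_all add: iota_v_def iota_c_def S_simps)

lemma algebra_morphism_iota:
  assumes "h \<in> hom C (Fo X) (Fo Y)" "h \<cdot> falg F X = falg F Y \<cdot> amap S h"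
  shows "h \<cdot> iota_v X = iota_v Y \<cdot> Sva h" "h \<cdot> iota_c X = iota_c Y \<cdot> Sca h h"
  using assms cmp_eq_assoc[OF assms(2), of "cinl C (Svo (Fo X)) (Sco (Fo X) (Fo X))"]
    cmp_eq_assoc[OF assms(2), of "cinr C (Svo (Fo X)) (Sco (Fo X) (Fo X))"]
  by (simp_all add: iota_v_def iota_c_def S_simps)

lemmas Fmult_iota = algebra_morphism_iota[OF _ Fmult_falg, simplified]

section \<open>The initial algebra\<close>

lemma mu_simps [simp]: "Fo (zero C) = mu" "Svo mu = V" "Sco mu mu = K" "omap S mu = V \<oplus> K"
  by (simp_all add: mu_def V_def K_def S_simps)

lemma iota_arr [simp]: "iota \<in> arrs C" "src C iota = V \<oplus> K" "tgt C iota = mu"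
  by (simp_all add: iota_def)

lemma initial_eqI:
  assumes "a \<in> hom C (omap S A) A" "h \<in> hom C mu A" "k \<in> hom C mu A"
    "h \<cdot> iota = a \<cdot> amap S h" "k \<cdot> iota = a \<cdot> amap S k"
  shows "h = k"
proof (rule free_eqI[where X = "zero C" and A = A and a = a])
  have "h \<cdot> funit F (zero C) \<in> hom C (zero C) A" "k \<cdot> funit F (zero C) \<in> hom C (zero C) A"
    using assms by simp_all
  then show "h \<cdot> funit F (zero C) = k \<cdot> funit F (zero C)" using initial by blast
qed (use assms in \<open>simp_all flip: iota_def\<close>)

lemma initial_ex:
  assumes "a \<in> hom C (omap S A) A"
  obtains h where "h \<in> hom C mu A" "h \<cdot> iota = a \<cdot> amap S h"
proof -
  obtain f where "f \<in> hom C (zero C) A" using initial by blast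
  with free_ext_ex1[OF assms] obtain h where "is_free_ext C S F (zero C) A a f h" by blast
  then show ?thesis using that unfolding is_free_ext_def mu_def iota_def by blast
qed

text \<open>Lambek's lemma: the morphism \<open>h\<close> from the initial algebra to the algebra
  \<open>amap S iota\<close> inverts \<open>iota\<close>.\<close>

lemma iota_iso: "is_iso C iota"
proof -
  obtain h where h: "h \<in> hom C mu (omap S mu)" "h \<cdot> iota = amap S iota \<cdot> amap S h"
    by (rule initial_ex[of "amap S iota"]) simp_all
  have ih: "iota \<cdot> h = idn C mu"
  proof (rule initial_eqI)
    show "(iota \<cdot> h) \<cdot> iota = iota \<cdot> amap S (iota \<cdot> h)"
      using h by (simp flip: S_S)
  qed (use h in \<open>simp_all add: S_idn\<close>)
  have "h \<cdot> iota = amap S (iota \<cdot> h)"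
    using h by (simp add: S_S)
  then show ?thesis unfolding is_iso_def using h(1) ih by (intro conjI bexI[of _ h]) (simp_all add: S_idn)
qed

definition "e = inv_arr C iota"

lemma e_simps [simp]: "e \<in> arrs C" "src C e = mu" "tgt C e = V \<oplus> K"
  "e \<cdot> iota = idn C (V \<oplus> K)" "iota \<cdot> e = idn C mu"
  using inv_arr[OF iota_iso] by (auto simp: e_def)

abbreviation "iv \<equiv> iota_v (zero C)"
abbreviation "ic \<equiv> iota_c (zero C)"

lemma iota_inj [simp]: "iota \<cdot> cinl C V K = iv" "iota \<cdot> cinr C V K = ic"
  by (simp_all add: iota_v_def iota_c_def iota_def)

lemma e_iota [simp]: "e \<cdot> iv = cinl C V K" "e \<cdot> ic = cinr C V K"
  using cmp_assoc'[of "cinl C V K" iota e] cmp_assoc'[of "cinr C V K" iota e] by simp_all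

lemma iota_copair: "\<lblot>iv, ic\<rblot> = iota"
  by (rule copair_eqI[of _ V K mu]) simp_all

lemma mu_eqI:
  assumes "f \<in> hom C mu Z" "g \<in> hom C mu Z" "f \<cdot> iv = g \<cdot> iv" "f \<cdot> ic = g \<cdot> ic"
  shows "f = g"
proof -
  have "f \<cdot> iota = g \<cdot> iota"
    using assms by (simp add: cmp_copair flip: iota_copair)
  then have "(f \<cdot> iota) \<cdot> e = (g \<cdot> iota) \<cdot> e" by simp
  then show ?thesis using assms by simp
qed

text \<open>Pairing a solution with the identity turns primitive recursion into plain iteration:
  \<open>\<langle>idn C mu, h\<rangle>\<close> is an algebra morphism into
  \<open>mu \<otimes> A\<close>, whose first component rebuilds the term.\<close>

lemma primitive_recursion_eqI:
  assumes a: "a \<in> hom C (omap S (mu \<otimes> A)) A" and h: "h \<in> hom C mu A" "k \<in> hom C mu A"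
    "h \<cdot> iota = a \<cdot> amap S \<langle>idn C mu, h\<rangle>" "k \<cdot> iota = a \<cdot> amap S \<langle>idn C mu, k\<rangle>"
  shows "h = k"
proof -
  let ?a = "\<langle>iota \<cdot> amap S (pfst C mu A), a\<rangle>"
  have rec: "\<langle>idn C mu, h\<rangle> \<cdot> iota = ?a \<cdot> amap S \<langle>idn C mu, h\<rangle>"
    if "h \<in> hom C mu A" "h \<cdot> iota = a \<cdot> amap S \<langle>idn C mu, h\<rangle>" for h
    using that a by (simp add: pair_cmp S_S S_idn)
  have "\<langle>idn C mu, h\<rangle> = \<langle>idn C mu, k\<rangle>"
    by (rule initial_eqI[of ?a "mu \<otimes> A"]) (use rec[of h] rec[of k] a h in simp_all)
  then have "psnd C mu A \<cdot> \<langle>idn C mu, h\<rangle> = psnd C mu A \<cdot> \<langle>idn C mu, k\<rangle>" by simp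
  then show ?thesis using h by simp
qed

lemma primitive_recursion_ex:
  assumes a: "a \<in> hom C (omap S (mu \<otimes> A)) A"
  obtains h where "h \<in> hom C mu A" "h \<cdot> iota = a \<cdot> amap S \<langle>idn C mu, h\<rangle>"
proof -
  let ?a = "\<langle>iota \<cdot> amap S (pfst C mu A), a\<rangle>"
  obtain p where p: "p \<in> hom C mu (mu \<otimes> A)" "p \<cdot> iota = ?a \<cdot> amap S p"
    by (rule initial_ex[of ?a "mu \<otimes> A"]) (use a in simp_all)
  \<comment> \<open>The first component of the iterate is an algebra endomorphism of
    \<open>mu\<close>, hence the identity; so \<open>p\<close> has the form of a pairing with the
    identity.\<close>
  have fst: "pfst C mu A \<cdot> p = idn C mu"
  proof (rule initial_eqI[of iota])
    show "(pfst C mu A \<cdot> p) \<cdot> iota = iota \<cdot> amap S (pfst C mu A \<cdot> p)"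
      using p a by (simp add: pair_cmp S_S)
  qed (use p in \<open>simp_all add: S_idn\<close>)
  show ?thesis
  proof (rule that[of "psnd C mu A \<cdot> p"])
    have "\<langle>idn C mu, psnd C mu A \<cdot> p\<rangle> = p" using pair_unique[OF p(1)] fst by simp
    then show "(psnd C mu A \<cdot> p) \<cdot> iota = a \<cdot> amap S \<langle>idn C mu, psnd C mu A \<cdot> p\<rangle>"
      using p a by (simp add: pair_cmp)
  qed (use p in simp)
qed

end

section \<open>The operational model\<close>

locale separated_semantics =
  hogsos_syntax C Sv Sc F T D \<rho>v \<rho>c \<chi> + distributive_monad C T le +
  separated_law C Sv Sc F T D \<rho>v \<rho>c \<chi> + computation_splitting C Sc \<Theta> \<theta>
  for C :: "('o, 'm) bicart" (structure)
    and Sv :: "('o, 'm, 'o, 'm) func"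
    and Sc :: "('o \<times> 'o, 'm \<times> 'm, 'o, 'm) func"
    and F :: "('o, 'm) free_algs"
    and T :: "('o, 'm) smonad"
    and D :: "('o \<times> 'o, 'm \<times> 'm, 'o, 'm) func"
    and \<rho>v :: "'o \<Rightarrow> 'm"
    and \<rho>c :: "'o \<Rightarrow> 'o \<Rightarrow> 'm"
    and \<chi> :: "'o \<Rightarrow> 'o \<Rightarrow> 'm"
    and le :: "'o \<Rightarrow> 'o \<Rightarrow> 'm \<Rightarrow> 'm \<Rightarrow> bool"
    and \<Theta> :: "('o \<times> 'o \<times> 'o, 'm \<times> 'm \<times> 'm, 'o, 'm) func"
    and \<theta> :: "'o \<Rightarrow> 'o \<Rightarrow> 'o \<Rightarrow> 'm" +
  assumes separated: "strongly_separated \<theta>"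
    and chi_cont: "chi_omega_continuous le"
begin

abbreviation "\<Theta>o X Y Z \<equiv> omap \<Theta> (X, Y, Z)"
abbreviation "\<Theta>a f g h \<equiv> amap \<Theta> (f, g, h)"

lemma B_simps [simp]: "Bo X Y = To (Do X Y) \<oplus> To Y" "Ba f g = Ta (Da f g) \<oplus>\<^sub>m Ta g"
  by (simp_all add: B_def)

lemma law_arr [simp]:
  "\<rho>v X \<in> arrs C" "src C (\<rho>v X) = Svo X" "tgt C (\<rho>v X) = Do X (Fo X)"
  "\<rho>c X Y \<in> arrs C" "src C (\<rho>c X Y) = Sco (X \<otimes> (To (Do X Y) \<oplus> To Y)) X"
  "tgt C (\<rho>c X Y) = To (Fo (X \<oplus> Y))"
  "\<chi> X Y \<in> arrs C" "src C (\<chi> X Y) = Sco (To X) Y" "tgt C (\<chi> X Y) = To (Sco X Y)"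
  using \<rho>v_hom[of X] \<rho>c_hom[of X Y] \<chi>_hom[of X Y] by auto

lemma \<theta>_arr [simp]:
  "\<theta> X Y Z \<in> arrs C" "src C (\<theta> X Y Z) = \<Theta>o X Y Z" "tgt C (\<theta> X Y Z) = Sco (X \<oplus> Y) Z"
  using coproduct[of X Z Y] unfolding is_coproduct_def by simp_all

lemma \<Theta>a_arr [simp]:
  assumes "f \<in> arrs C" "g \<in> arrs C" "h \<in> arrs C"
  shows "\<Theta>a f g h \<in> arrs C" "src C (\<Theta>a f g h) = \<Theta>o (src C f) (src C g) (src C h)"
    "tgt C (\<Theta>a f g h) = \<Theta>o (tgt C f) (tgt C g) (tgt C h)"
proof -
  have "(f, g, h) \<in> hom (C \<times>\<^sub>C C \<times>\<^sub>C C) (src C f, src C g, src C h) (tgt C f, tgt C g, tgt C h)"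
    using assms by (simp add: prod_cat_def)
  then have "\<Theta>a f g h \<in> hom C (\<Theta>o (src C f) (src C g) (src C h)) (\<Theta>o (tgt C f) (tgt C g) (tgt C h))"
    using functor_\<Theta> unfolding is_functor_def by blast
  then show "\<Theta>a f g h \<in> arrs C" "src C (\<Theta>a f g h) = \<Theta>o (src C f) (src C g) (src C h)"
    "tgt C (\<Theta>a f g h) = \<Theta>o (tgt C f) (tgt C g) (tgt C h)" by auto
qed

lemma nabla_sharp_arr [simp]:
  "nabla_sharp X \<in> arrs C" "src C (nabla_sharp X) = Fo (Fo X \<oplus> Fo X)" "tgt C (nabla_sharp X) = Fo X"
  by (simp_all add: nabla_sharp_def)

lemma gamma_v_arr [simp]:
  "gamma_v \<in> arrs C" "src C gamma_v = V" "tgt C gamma_v = To (Do mu mu)"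
  by (simp_all add: gamma_v_def)

text \<open>Makes the definite description of \<open>gamma_c\<close> meaningful. The unknown
  \<open>g\<close> corresponds to the full operational model
  \<open>(gamma_v \<oplus>\<^sub>m g) \<cdot> e\<close> from \<open>mu\<close> to
  \<open>Bo mu mu\<close>, and that arrow is given by primitive recursion.\<close>

lemma gamma_c_ex1:
  "\<exists>!g. g \<in> hom C K (To mu) \<and> g \<cdot> Sca iota (idn C mu) =
     Ta (nabla_sharp (zero C)) \<cdot> \<rho>c mu mu \<cdot> Sca \<langle>iota, gamma_v \<oplus>\<^sub>m g\<rangle> (idn C mu)"
proof -
  define N where "N = Ta (nabla_sharp (zero C)) \<cdot> \<rho>c mu mu"
  let ?B = "To (Do mu mu) \<oplus> To mu"
  have N [simp]: "N \<in> arrs C" "src C N = Sco (mu \<otimes> ?B) mu" "tgt C N = To mu"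
    by (simp_all add: N_def)
  let ?P = "\<lambda>g. g \<in> hom C K (To mu) \<and>
    g \<cdot> Sca iota (idn C mu) = N \<cdot> Sca \<langle>iota, gamma_v \<oplus>\<^sub>m g\<rangle> (idn C mu)"
  \<comment> \<open>Values only look at the subterms; computations also see the behaviour of their
    first argument, while the second argument is kept as a term.\<close>
  let ?a = "(gamma_v \<cdot> Sva (pfst C mu ?B)) \<oplus>\<^sub>m (N \<cdot> Sca (idn C (mu \<otimes> ?B)) (pfst C mu ?B))"
  have a: "?a \<in> hom C (omap S (mu \<otimes> ?B)) ?B" by (simp add: S_simps)
  have rec: "?a \<cdot> amap S \<langle>idn C mu, h\<rangle> = gamma_v \<oplus>\<^sub>m (N \<cdot> Sca \<langle>idn C mu, h\<rangle> (idn C mu))"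
    if "h \<in> hom C mu ?B" for h
    using that by (simp add: S_simps cmap_cmap Sva_Sva Sca_Sca)
  obtain h where h: "h \<in> hom C mu ?B" "h \<cdot> iota = ?a \<cdot> amap S \<langle>idn C mu, h\<rangle>"
    using primitive_recursion_ex[OF a] by blast
  let ?g = "N \<cdot> Sca \<langle>idn C mu, h\<rangle> (idn C mu)"
  have "?P ?g"
    using h rec[OF h(1)] by (simp add: Sca_Sca pair_cmp)
  \<comment> \<open>Since \<open>iota\<close> is invertible, \<open>g\<close> is recovered from the
    model \<open>?h\<close> it induces, and \<open>?h\<close> solves the same recursion as
    \<open>h\<close>.\<close>
  moreover have "g = ?g" if "?P g" for g
  proof -
    let ?h = "(gamma_v \<oplus>\<^sub>m g) \<cdot> e"
    have "g \<in> hom C K (To mu)" using that by blast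
    then have "g = (g \<cdot> Sca iota (idn C mu)) \<cdot> Sca e (idn C mu)"
      by (simp add: Sca_Sca)
    also have "\<dots> = N \<cdot> Sca \<langle>idn C mu, ?h\<rangle> (idn C mu)"
      using that by (simp add: Sca_Sca pair_cmp)
    finally have g: "g = N \<cdot> Sca \<langle>idn C mu, ?h\<rangle> (idn C mu)" .
    have h': "?h \<in> hom C mu ?B" using that by simp
    have "?h \<cdot> iota = ?a \<cdot> amap S \<langle>idn C mu, ?h\<rangle>"
      unfolding rec[OF h'] using that by (simp flip: g)
    then have "?h = h" using primitive_recursion_eqI[OF a h' h(1)] h(2) by blast
    then show ?thesis using g by simp
  qed
  ultimately have "\<exists>!g. ?P g" by blast
  then show ?thesis by (simp add: N_def cong: conj_cong)
qed

lemma gamma_c_arr [simp]: "gamma_c \<in> arrs C" "src C gamma_c = K" "tgt C gamma_c = To mu"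
  and gamma_c_iota: "gamma_c \<cdot> Sca iota (idn C mu) =
     Ta (nabla_sharp (zero C)) \<cdot> \<rho>c mu mu \<cdot> Sca \<langle>iota, gamma_v \<oplus>\<^sub>m gamma_c\<rangle> (idn C mu)"
  using theI'[OF gamma_c_ex1] unfolding gamma_c_def[symmetric] by auto

section \<open>The big-step transformation evaluated on the initial algebra\<close>

definition "v = gamma_c \<cdot> Sca iv (idn C mu)"

lemma v_arr [simp]: "v \<in> arrs C" "src C v = Sco V mu" "tgt C v = To mu"
  by (simp_all add: v_def)

text \<open>Compatibility of \<open>nabla_sharp\<close> with the algebra morphism
  \<open>Fmult X\<close>; both sides reduce to
  \<open>Fmult X \<cdot> Fa \<lblot>Fmult X, Fmult X\<rblot>\<close> by associativity of the free
  monad.\<close>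

lemma nabla_sharp_Fmult:
  "nabla_sharp X \<cdot> Fa (Fmult X \<oplus>\<^sub>m Fmult X) = Fmult X \<cdot> nabla_sharp (Fo X)"
proof -
  have "nabla_sharp X \<cdot> Fa (Fmult X \<oplus>\<^sub>m Fmult X) = Fmult X \<cdot> Fa \<lblot>Fmult X, Fmult X\<rblot>"
    by (simp add: nabla_sharp_def Fa_Fa copair_cmap)
  also have "\<dots> = Fmult X \<cdot> Fa (Fmult X) \<cdot> Fa \<lblot>idn C (Fo (Fo X)), idn C (Fo (Fo X))\<rblot>"
    by (simp add: Fa_Fa cmp_copair)
  also have "\<dots> = Fmult X \<cdot> nabla_sharp (Fo X)"
    using cmp_eq_assoc[OF Fmult_Fmult, of "Fa \<lblot>idn C (Fo (Fo X)), idn C (Fo (Fo X))\<rblot>" X]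
    by (simp add: nabla_sharp_def)
  finally show ?thesis .
qed

text \<open>\<open>xi mu\<close> applies the rules at the object \<open>Fo mu\<close>, whereas
  \<open>v\<close> applies them at \<open>mu\<close>. Dinaturality of both rules along the
  evaluation \<open>m\<close> from \<open>Fo mu\<close> to \<open>mu\<close> moves between the two,
  and naturality of \<open>\<rho>c\<close> treats its second argument.\<close>

lemma Fmult_xi: "Ta (Fmult (zero C)) \<cdot> xi mu = v"
proof -
  define m where "m = Fmult (zero C)"
  define M where "M = Fo mu"
  \<comment> \<open>\<open>u\<close> and \<open>d\<close> are the two components that
    \<open>xi mu\<close> feeds into \<open>\<rho>c\<close>: a value over generators as a term, and
    its one-step behaviour.\<close>
  define u where "u = iota_v mu \<cdot> Sva (funit F mu)"
  define d where "d = munit T (Do M M) \<cdot> Da (idn C M) (Fmult mu) \<cdot> \<rho>v M \<cdot> Sva (funit F mu)"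
  have m [simp]: "m \<in> arrs C" "src C m = M" "tgt C m = mu" by (simp_all add: m_def M_def)
  have u [simp]: "u \<in> arrs C" "src C u = V" "tgt C u = M" by (simp_all add: u_def M_def)
  have d [simp]: "d \<in> arrs C" "src C d = V" "tgt C d = To (Do M M)" by (simp_all add: d_def M_def)
  have unit [simp]: "m \<cdot> funit F mu = idn C mu"
    using Fmult_funit[of "zero C"] by (simp add: m_def)
  have mu: "m \<cdot> u = iv"
    using cmp_eq_assoc[OF Fmult_iota(1), of "Sva (funit F mu)" "zero C"] unit
    by (simp add: u_def M_def Sva_Sva flip: m_def)
  let ?inl = "\<lambda>X Y. cinl C (To (Do X Y)) (To Y)"
  have xi: "xi mu = Ta (nabla_sharp mu) \<cdot> \<rho>c M M \<cdot> Sca \<langle>u, ?inl M M \<cdot> d\<rangle> (funit F mu)"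
    by (simp add: xi_def rho_cv_def u_def d_def M_def Sca_Sca pmap_pair pair_cmp)
  \<comment> \<open>Both behaviours are compared in the mixed object \<open>Do M mu\<close>.
    Inserting \<open>m \<cdot> funit F mu = idn C mu\<close> exposes the dinaturality square of
    \<open>\<rho>v\<close>.\<close>
  have d_eq: "Da m (idn C mu) \<cdot> Da (idn C mu) m \<cdot> \<rho>v mu
      = Da (idn C M) m \<cdot> Da (idn C M) (Fmult mu) \<cdot> \<rho>v M \<cdot> Sva (funit F mu)"
  proof -
    have "Da m (idn C mu) \<cdot> Da (idn C mu) m \<cdot> \<rho>v mu
      = Da (idn C M) m \<cdot> (Da m (idn C M) \<cdot> \<rho>v mu \<cdot> Sva m) \<cdot> Sva (funit F mu)"
      by (simp add: Da_Da Sva_Sva M_def)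
    also have "Da m (idn C M) \<cdot> \<rho>v mu \<cdot> Sva m = Da (idn C M) (Fa m) \<cdot> \<rho>v M"
      using \<rho>v_dinatural[of m M mu] by (simp add: M_def)
    also have "Da (idn C M) m \<cdot> (Da (idn C M) (Fa m) \<cdot> \<rho>v M) \<cdot> Sva (funit F mu)
      = Da (idn C M) (m \<cdot> Fa m) \<cdot> \<rho>v M \<cdot> Sva (funit F mu)"
      by (simp add: Da_Da M_def)
    also have "m \<cdot> Fa m = m \<cdot> Fmult mu" using Fmult_Fmult[of "zero C"] by (simp add: m_def)
    finally show ?thesis by (simp add: Da_Da M_def)
  qed
  have Ba: "Ba m (idn C mu) \<cdot> ?inl mu mu \<cdot> gamma_v = Ba (idn C M) m \<cdot> ?inl M M \<cdot> d"
    using d_eq by (simp add: gamma_v_def d_def Ta_munit_cmp M_def flip: m_def)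
  let ?i = "idn C (To (Do mu mu) \<oplus> To mu)"
  have "v = Ta (nabla_sharp (zero C)) \<cdot> \<rho>c mu mu \<cdot> Sca \<langle>iv, ?inl mu mu \<cdot> gamma_v\<rangle> (idn C mu)"
  proof -
    have "v = (gamma_c \<cdot> Sca iota (idn C mu)) \<cdot> Sca (cinl C V K) (idn C mu)"
      by (simp add: v_def Sca_Sca)
    then show ?thesis unfolding gamma_c_iota by (simp add: Sca_Sca pair_cmp)
  qed
  \<comment> \<open>Writing \<open>iv\<close> as \<open>m \<cdot> u\<close> and the identity as
    \<open>m \<cdot> funit F mu\<close> produces one side of the dinaturality square of
    \<open>\<rho>c\<close>.\<close>
  also have "\<dots> = Ta (nabla_sharp (zero C)) \<cdot> (\<rho>c mu mu \<cdot> Sca (m \<otimes>\<^sub>m ?i) m)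
      \<cdot> Sca \<langle>u, ?inl mu mu \<cdot> gamma_v\<rangle> (funit F mu)"
    by (simp add: Sca_Sca pmap_pair mu M_def)
  also have "\<rho>c mu mu \<cdot> Sca (m \<otimes>\<^sub>m ?i) m = Ta (Fa (m \<oplus>\<^sub>m idn C mu)) \<cdot> \<rho>c M mu
      \<cdot> Sca (idn C M \<otimes>\<^sub>m Ba m (idn C mu)) (idn C M)"
    using \<rho>c_dinatural[of m M mu mu] by simp
  also have "Ta (nabla_sharp (zero C)) \<cdot> (Ta (Fa (m \<oplus>\<^sub>m idn C mu)) \<cdot> \<rho>c M mu
      \<cdot> Sca (idn C M \<otimes>\<^sub>m Ba m (idn C mu)) (idn C M)) \<cdot> Sca \<langle>u, ?inl mu mu \<cdot> gamma_v\<rangle> (funit F mu)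
    = Ta (nabla_sharp (zero C)) \<cdot> Ta (Fa (m \<oplus>\<^sub>m idn C mu)) \<cdot> \<rho>c M mu
      \<cdot> Sca \<langle>u, Ba m (idn C mu) \<cdot> ?inl mu mu \<cdot> gamma_v\<rangle> (funit F mu)"
    by (simp add: Sca_Sca pmap_pair M_def)
  also have "\<dots> = Ta (nabla_sharp (zero C)) \<cdot> Ta (Fa (m \<oplus>\<^sub>m idn C mu))
      \<cdot> (\<rho>c M mu \<cdot> Sca (idn C M \<otimes>\<^sub>m Ba (idn C M) m) (idn C M))
      \<cdot> Sca \<langle>u, ?inl M M \<cdot> d\<rangle> (funit F mu)"
    unfolding Ba by (simp add: Sca_Sca pmap_pair M_def)
  also have "\<rho>c M mu \<cdot> Sca (idn C M \<otimes>\<^sub>m Ba (idn C M) m) (idn C M) = Ta (Fa (idn C M \<oplus>\<^sub>m m)) \<cdot> \<rho>c M M"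
    using \<rho>c_natural[of m M mu M] by simp
  also have "Ta (nabla_sharp (zero C)) \<cdot> Ta (Fa (m \<oplus>\<^sub>m idn C mu)) \<cdot> (Ta (Fa (idn C M \<oplus>\<^sub>m m)) \<cdot> \<rho>c M M)
      \<cdot> Sca \<langle>u, ?inl M M \<cdot> d\<rangle> (funit F mu)
    = Ta (nabla_sharp (zero C) \<cdot> Fa (m \<oplus>\<^sub>m m)) \<cdot> \<rho>c M M \<cdot> Sca \<langle>u, ?inl M M \<cdot> d\<rangle> (funit F mu)"
  proof -
    have "Fa (m \<oplus>\<^sub>m m) = Fa (m \<oplus>\<^sub>m idn C mu) \<cdot> Fa (idn C M \<oplus>\<^sub>m m)"
      by (simp add: Fa_Fa cmap_cmap)
    then show ?thesis by (simp add: Ta_cmp M_def)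
  qed
  also have "nabla_sharp (zero C) \<cdot> Fa (m \<oplus>\<^sub>m m) = m \<cdot> nabla_sharp mu"
    using nabla_sharp_Fmult[of "zero C"] by (simp add: m_def)
  finally show ?thesis unfolding xi by (simp add: Ta_cmp M_def flip: m_def)
qed

section \<open>The total one-step map and strong separation\<close>

definition "kappa = \<lblot>munit T mu \<cdot> iv, gamma_c\<rblot> \<cdot> e"

lemma kappa_arr [simp]: "kappa \<in> arrs C" "src C kappa = mu" "tgt C kappa = To mu"
  by (simp_all add: kappa_def)

lemma kappa_iota [simp]: "kappa \<cdot> iv = munit T mu \<cdot> iv" "kappa \<cdot> ic = gamma_c"
  "kappa \<cdot> iota = \<lblot>munit T mu \<cdot> iv, gamma_c\<rblot>"
  by (simp_all add: kappa_def)

text \<open>The splitting concerns \<open>Sco (V \<oplus> K) mu\<close>; composing with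
  \<open>iota\<close> in the first argument makes its \<open>\<theta>\<close> part the second
  injection into \<open>K\<close>.\<close>

definition "J = Sca iota (idn C mu) \<cdot> \<theta> V K mu"

lemma J_arr [simp]: "J \<in> arrs C" "src C J = \<Theta>o V K mu" "tgt C J = K"
  by (simp_all add: J_def)

text \<open>\<open>nabla_sharp X\<close> is the algebra morphism extending the codiagonal, so it
  passes through one layer of \<open>iota_c\<close> and acts as the codiagonal on the generators
  underneath.\<close>

lemma nabla_sharp_iota_c:
  "nabla_sharp X \<cdot> iota_c (Fo X \<oplus> Fo X) \<cdot> Sca (funit F (Fo X \<oplus> Fo X)) (funit F (Fo X \<oplus> Fo X)) =
   iota_c X \<cdot> Sca \<lblot>idn C (Fo X), idn C (Fo X)\<rblot> \<lblot>idn C (Fo X), idn C (Fo X)\<rblot>"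
proof -
  let ?n = "\<lblot>idn C (Fo X), idn C (Fo X)\<rblot>" and ?Y = "Fo X \<oplus> Fo X"
  have alg: "nabla_sharp X \<cdot> falg F ?Y = falg F X \<cdot> amap S (nabla_sharp X)"
    using cmp_eq_assoc[OF Fmult_falg, of "amap S (Fa ?n)" X]
    by (simp add: nabla_sharp_def Fa_falg flip: S_S)
  have unit: "nabla_sharp X \<cdot> funit F ?Y = ?n"
    using cmp_eq_assoc[OF Fmult_funit, of ?n X] by (simp add: nabla_sharp_def Fa_funit)
  have "nabla_sharp X \<cdot> iota_c ?Y = iota_c X \<cdot> Sca (nabla_sharp X) (nabla_sharp X)"
    using algebra_morphism_iota(2)[OF _ alg] by simp
  from cmp_eq_assoc[OF this, of "Sca (funit F ?Y) (funit F ?Y)"] show ?thesis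
    by (simp add: Sca_Sca unit)
qed

lemma gamma_c_J: "gamma_c \<cdot> J = Ta ic \<cdot> \<chi> mu mu \<cdot> Sca kappa (idn C mu) \<cdot> J"
proof -
  let ?P = "mu \<otimes> To (Do mu mu)" and ?Q = "mu \<otimes> To mu" and ?M = "mu \<oplus> mu"
  let ?inl = "cinl C (To (Do mu mu)) (To mu)" and ?inr = "cinr C (To (Do mu mu)) (To mu)"
  let ?n = "\<lblot>idn C mu, idn C mu\<rblot>"
  define \<delta> where "\<delta> = \<lblot>idn C mu \<otimes>\<^sub>m ?inl, idn C mu \<otimes>\<^sub>m ?inr\<rblot>"
  define \<sigma> where "\<sigma> = ksum C T mu mu (Ta (pfst C mu (Do mu mu)) \<cdot> mstr T mu (Do mu mu)) (psnd C mu (To mu))"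
  define f where "f = \<langle>iv, gamma_v\<rangle>"
  define g where "g = \<langle>ic, gamma_c\<rangle>"
  define s where "s = iota_c ?M \<cdot> Sca (funit F ?M) (funit F ?M)"
  have \<delta> [simp]: "\<delta> \<in> arrs C" "src C \<delta> = ?P \<oplus> ?Q" "tgt C \<delta> = mu \<otimes> (To (Do mu mu) \<oplus> To mu)"
    by (simp_all add: \<delta>_def)
  have \<sigma> [simp]: "\<sigma> \<in> arrs C" "src C \<sigma> = ?P \<oplus> ?Q" "tgt C \<sigma> = To ?M"
    by (simp_all add: \<sigma>_def ksum_def)
  have f [simp]: "f \<in> arrs C" "src C f = V" "tgt C f = ?P" by (simp_all add: f_def)
  have g [simp]: "g \<in> arrs C" "src C g = K" "tgt C g = ?Q" by (simp_all add: g_def)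
  have s [simp]: "s \<in> arrs C" "src C s = Sco ?M ?M" "tgt C s = Fo ?M" by (simp_all add: s_def)
  have sep: "\<rho>c mu mu \<cdot> Sca \<delta> (idn C mu) \<cdot> \<theta> ?P ?Q mu
      = Ta s \<cdot> \<chi> ?M ?M \<cdot> Sca \<sigma> (cinl C mu mu) \<cdot> \<theta> ?P ?Q mu"
    using separated unfolding strongly_separated_def Let_def \<delta>_def \<sigma>_def s_def by blast
  have nat: "Sca (f \<oplus>\<^sub>m g) (idn C mu) \<cdot> \<theta> V K mu = \<theta> ?P ?Q mu \<cdot> \<Theta>a f g (idn C mu)"
    by (rule \<theta>_natural) simp_all
  \<comment> \<open>The operational model treats values and computations separately, so it factors
    through \<open>\<delta>\<close>, the shape in which strong separation is stated.\<close>
  have model: "\<langle>iota, gamma_v \<oplus>\<^sub>m gamma_c\<rangle> = \<delta> \<cdot> (f \<oplus>\<^sub>m g)"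
    by (rule copair_eqI[of _ V K "mu \<otimes> (To (Do mu mu) \<oplus> To mu)"])
       (simp_all add: pair_cmp \<delta>_def pmap_pair f_def g_def)
  \<comment> \<open>The behaviour of a value is pure, since \<open>gamma_v\<close> factors through
    the unit; the strength then only returns the value itself.\<close>
  have strength: "Ta (pfst C mu (Do mu mu)) \<cdot> mstr T mu (Do mu mu) \<cdot> f = munit T mu \<cdot> iv"
  proof -
    let ?d = "Da (idn C mu) (Fmult (zero C)) \<cdot> \<rho>v mu"
    have "f = (idn C mu \<otimes>\<^sub>m munit T (Do mu mu)) \<cdot> \<langle>iv, ?d\<rangle>"
      by (simp add: f_def gamma_v_def pmap_pair)
    then have "mstr T mu (Do mu mu) \<cdot> f = munit T (mu \<otimes> Do mu mu) \<cdot> \<langle>iv, ?d\<rangle>"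
      using cmp_eq_assoc[OF mstr_munit, of "\<langle>iv, ?d\<rangle>" mu "Do mu mu"] by simp
    then show ?thesis by (simp add: Ta_munit_cmp)
  qed
  \<comment> \<open>After identifying the two copies of \<open>mu\<close>, \<open>\<sigma>\<close>
    keeps a value in place and lets a computation move by \<open>gamma_c\<close>, which is
    \<open>kappa\<close>.\<close>
  have fold: "Ta ?n \<cdot> \<sigma> \<cdot> (f \<oplus>\<^sub>m g) = kappa \<cdot> iota"
  proof (rule copair_eqI[of _ V K "To mu"])
    have T_n: "Ta ?n \<cdot> Ta i \<cdot> h = h" if "?n \<cdot> i = idn C mu" "i \<in> hom C mu ?M" "h \<in> hom C X (To mu)" for i h X
    proof -
      have "Ta ?n \<cdot> Ta i = idn C (To mu)" using that Ta_cmp[of i ?n] by simp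
      from cmp_eq_assoc[OF this, of h] show ?thesis using that by simp
    qed
    show "(Ta ?n \<cdot> \<sigma> \<cdot> (f \<oplus>\<^sub>m g)) \<cdot> cinl C V K = (kappa \<cdot> iota) \<cdot> cinl C V K"
      by (simp add: \<sigma>_def ksum_def strength T_n[of _ _ V])
    show "(Ta ?n \<cdot> \<sigma> \<cdot> (f \<oplus>\<^sub>m g)) \<cdot> cinr C V K = (kappa \<cdot> iota) \<cdot> cinr C V K"
      by (simp add: \<sigma>_def ksum_def g_def T_n[of _ _ K])
  qed simp_all
  have alg: "nabla_sharp (zero C) \<cdot> s = ic \<cdot> Sca ?n ?n"
    using nabla_sharp_iota_c[of "zero C"] by (simp add: s_def)
  have "gamma_c \<cdot> J = (gamma_c \<cdot> Sca iota (idn C mu)) \<cdot> \<theta> V K mu"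
    by (simp add: J_def)
  also have "\<dots> = Ta (nabla_sharp (zero C)) \<cdot> \<rho>c mu mu \<cdot> Sca \<delta> (idn C mu)
      \<cdot> (Sca (f \<oplus>\<^sub>m g) (idn C mu) \<cdot> \<theta> V K mu)"
    unfolding gamma_c_iota model by (simp add: Sca_Sca)
  also have "\<dots> = Ta (nabla_sharp (zero C)) \<cdot> (\<rho>c mu mu \<cdot> Sca \<delta> (idn C mu) \<cdot> \<theta> ?P ?Q mu)
      \<cdot> \<Theta>a f g (idn C mu)"
    unfolding nat by simp
  also have "\<dots> = Ta (nabla_sharp (zero C)) \<cdot> Ta s \<cdot> \<chi> ?M ?M \<cdot> Sca \<sigma> (cinl C mu mu)
      \<cdot> (\<theta> ?P ?Q mu \<cdot> \<Theta>a f g (idn C mu))"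
    unfolding sep by simp
  also have "\<dots> = Ta (nabla_sharp (zero C) \<cdot> s) \<cdot> \<chi> ?M ?M \<cdot> Sca (\<sigma> \<cdot> (f \<oplus>\<^sub>m g)) (cinl C mu mu) \<cdot> \<theta> V K mu"
    unfolding nat[symmetric] by (simp add: Sca_Sca Ta_cmp)
  also have "\<dots> = Ta ic \<cdot> (Ta (Sca ?n ?n) \<cdot> \<chi> ?M ?M) \<cdot> Sca (\<sigma> \<cdot> (f \<oplus>\<^sub>m g)) (cinl C mu mu) \<cdot> \<theta> V K mu"
    unfolding alg by (simp add: Ta_cmp)
  also have "Ta (Sca ?n ?n) \<cdot> \<chi> ?M ?M = \<chi> mu mu \<cdot> Sca (Ta ?n) ?n"
    by (rule \<chi>_natural) simp_all
  also have "Ta ic \<cdot> (\<chi> mu mu \<cdot> Sca (Ta ?n) ?n) \<cdot> Sca (\<sigma> \<cdot> (f \<oplus>\<^sub>m g)) (cinl C mu mu) \<cdot> \<theta> V K mu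
      = Ta ic \<cdot> \<chi> mu mu \<cdot> Sca (kappa \<cdot> iota) (idn C mu) \<cdot> \<theta> V K mu"
    using fold by (simp add: Sca_Sca)
  also have "\<dots> = Ta ic \<cdot> \<chi> mu mu \<cdot> Sca kappa (idn C mu) \<cdot> J"
    by (simp add: J_def Sca_Sca del: kappa_iota)
  finally show ?thesis .
qed

text \<open>The splitting of \<open>Sco (V \<oplus> K) mu\<close> is transported along the
  isomorphism \<open>iota\<close>. It separates the computations whose first argument is a value
  from the remaining ones, and all comparisons below are made on these two summands.\<close>

lemma K_coproduct: "is_coproduct C (Sco V mu) (\<Theta>o V K mu) K (Sca iv (idn C mu)) J"
  unfolding is_coproduct_def
proof (intro conjI allI ballI)
  fix Z f g
  assume f: "f \<in> hom C (Sco V mu) Z" and g: "g \<in> hom C (\<Theta>o V K mu) Z"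
  note cop = coproduct[of V mu K]
  obtain h where h: "h \<in> hom C (Sco (V \<oplus> K) mu) Z"
      "h \<cdot> Sca (cinl C V K) (idn C mu) = f" "h \<cdot> \<theta> V K mu = g"
    using cop f g unfolding is_coproduct_def by blast
  show "\<exists>!h. h \<in> hom C K Z \<and> h \<cdot> Sca iv (idn C mu) = f \<and> h \<cdot> J = g"
  proof
    show "h \<cdot> Sca e (idn C mu) \<in> hom C K Z \<and> (h \<cdot> Sca e (idn C mu)) \<cdot> Sca iv (idn C mu) = f
      \<and> (h \<cdot> Sca e (idn C mu)) \<cdot> J = g"
      using h by (simp add: Sca_Sca J_def)
  next
    fix k
    assume k: "k \<in> hom C K Z \<and> k \<cdot> Sca iv (idn C mu) = f \<and> k \<cdot> J = g"
    have "k \<cdot> Sca iota (idn C mu) = h"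
      by (rule coproduct_eqI[OF cop, of _ Z]) (use h k in \<open>simp_all add: Sca_Sca J_def\<close>)
    then have "h \<cdot> Sca e (idn C mu) = (k \<cdot> Sca iota (idn C mu)) \<cdot> Sca e (idn C mu)" by simp
    also have "\<dots> = k" using conjunct1[OF k] by (simp add: Sca_Sca)
    finally show "k = h \<cdot> Sca e (idn C mu)" by simp
  qed
qed simp_all

section \<open>Comparison of the fixpoints\<close>

text \<open>\<open>chi_V f\<close> runs \<open>f\<close> in the first argument, \<open>step\<close>
  lets the first argument make one small step, and \<open>hat\<close> extends a semantics of
  computations to all programs.\<close>

abbreviation "chi_V f \<equiv> \<chi> V mu \<cdot> Sca f (idn C mu)"
abbreviation "step \<equiv> \<chi> mu mu \<cdot> Sca kappa (idn C mu)"
abbreviation "hat f \<equiv> \<lblot>munit T V, f\<rblot> \<cdot> e"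

text \<open>The multiplication law of \<open>\<chi>\<close> in Kleisli form: lifting along
  \<open>\<chi>\<close> preserves Kleisli composition.\<close>

lemma chi_kl:
  assumes "f \<in> hom C W (To Y)" "g \<in> hom C U (To W)"
  shows "kl (Sco Y Z) (\<chi> Y Z \<cdot> Sca f (idn C Z)) \<cdot> \<chi> W Z \<cdot> Sca g (idn C Z)
    = \<chi> Y Z \<cdot> Sca (kl Y f \<cdot> g) (idn C Z)"
proof -
  have "kl (Sco Y Z) (\<chi> Y Z \<cdot> Sca f (idn C Z)) \<cdot> \<chi> W Z \<cdot> Sca g (idn C Z)
    = mmult T (Sco Y Z) \<cdot> Ta (\<chi> Y Z) \<cdot> (Ta (Sca f (idn C Z)) \<cdot> \<chi> W Z) \<cdot> Sca g (idn C Z)"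
    using assms by (simp add: klift_def Ta_cmp)
  also have "\<dots> = (mmult T (Sco Y Z) \<cdot> Ta (\<chi> Y Z) \<cdot> \<chi> (To Y) Z) \<cdot> Sca (Ta f \<cdot> g) (idn C Z)"
    using assms \<chi>_natural[of f W "To Y" "idn C Z" Z Z] by (simp add: Sca_Sca)
  also have "\<dots> = \<chi> Y Z \<cdot> Sca (kl Y f \<cdot> g) (idn C Z)"
    unfolding \<chi>_mmult[symmetric] using assms by (simp add: Sca_Sca klift_def)
  finally show ?thesis .
qed

lemma X_iv:
  assumes "f \<in> hom C mu (To V)" "f \<cdot> iv = munit T V"
  shows "chi_V f \<cdot> Sca iv (idn C mu) = munit T (Sco V mu)"
  using assms by (simp add: Sca_Sca \<chi>_munit)

text \<open>Evaluating a first argument that is already a value is pure by the unit law of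
  \<open>\<chi>\<close>, so only the continuation \<open>p\<close> remains.\<close>

lemma kl_X_iv:
  assumes "f \<in> hom C mu (To V)" "f \<cdot> iv = munit T V" "p \<in> hom C (Sco V mu) (To V)"
  shows "(kl V p \<cdot> chi_V f) \<cdot> Sca iv (idn C mu) = p"
  using assms X_iv[OF assms(1,2)] by simp

text \<open>By functoriality of the lifting, a step taken inside the first argument before its
  evaluation can be pulled to the front as \<open>step\<close>.\<close>

lemma kl_X_kappa:
  assumes "f \<in> hom C mu (To V)" "p \<in> hom C (Sco V mu) (To V)"
  shows "kl V p \<cdot> chi_V (kl V f \<cdot> kappa) = kl V (kl V p \<cdot> chi_V f) \<cdot> step"
proof -
  have "kl V p \<cdot> chi_V (kl V f \<cdot> kappa) = kl V p \<cdot> kl (Sco V mu) (chi_V f) \<cdot> step"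
    using assms chi_kl[of f mu V kappa mu mu] by simp
  also have "\<dots> = (kl V p \<cdot> kl (Sco V mu) (chi_V f)) \<cdot> step"
    using assms by simp
  also have "kl V p \<cdot> kl (Sco V mu) (chi_V f) = kl V (kl V p \<cdot> chi_V f)"
    using assms by (intro kl_kl) simp_all
  finally show ?thesis .
qed

text \<open>By \<open>gamma_c_J\<close>, a step on this summand is a step of the first argument that
  rebuilds a computation, so \<open>f\<close> is met only through
  \<open>f \<cdot> ic\<close>.\<close>

lemma kl_gamma_c_J:
  assumes "f \<in> hom C mu (To V)"
  shows "(kl V f \<cdot> gamma_c) \<cdot> J = (kl V (f \<cdot> ic) \<cdot> step) \<cdot> J"
proof -
  have "(kl V f \<cdot> gamma_c) \<cdot> J = (kl V f \<cdot> Ta ic) \<cdot> step \<cdot> J"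
    using assms by (simp add: gamma_c_J)
  also have "kl V f \<cdot> Ta ic = kl V (f \<cdot> ic)"
    using assms by (intro kl_Ta) simp_all
  finally show ?thesis using assms by simp
qed

text \<open>With the continuation \<open>p\<close> fixed, the recursive occurrence of
  \<open>h\<close> is applied to the first argument only, a proper subterm; the second argument
  stays a term, which makes this primitive recursion.\<close>

lemma structural_recursion_eqI:
  assumes p: "p \<in> hom C (Sco V mu) (To V)" and h: "h \<in> hom C mu (To V)" "k \<in> hom C mu (To V)"
    "h \<cdot> iv = munit T V" "k \<cdot> iv = munit T V" "h \<cdot> ic = kl V p \<cdot> chi_V h" "k \<cdot> ic = kl V p \<cdot> chi_V k"
  shows "h = k"
proof -
  let ?f = "pfst C mu (To V)"
  let ?a = "\<lblot>munit T V \<cdot> Sva ?f, kl V p \<cdot> \<chi> V mu \<cdot> Sca (psnd C mu (To V)) ?f\<rblot>"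
  have a: "?a \<in> hom C (omap S (mu \<otimes> To V)) (To V)" using p by (simp add: S_simps)
  have rec: "h \<cdot> iota = ?a \<cdot> amap S \<langle>idn C mu, h\<rangle>"
    if "h \<in> hom C mu (To V)" "h \<cdot> iv = munit T V" "h \<cdot> ic = kl V p \<cdot> chi_V h" for h
  proof -
    have "h \<cdot> iota = \<lblot>munit T V, kl V p \<cdot> chi_V h\<rblot>"
      using that by (simp add: cmp_copair flip: iota_copair)
    then show ?thesis using that p by (simp add: S_simps copair_cmap Sva_Sva Sca_Sca)
  qed
  show ?thesis by (rule primitive_recursion_eqI[OF a h(1,2)]) (use rec h in blast)+
qed

lemma hat_iota [simp]:
  assumes "f \<in> arrs C" "src C f = K" "tgt C f = To V"
  shows "hat f \<cdot> iv = munit T V" "hat f \<cdot> ic = f"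
  using assms by simp_all

text \<open>Both sides of the conclusion solve the structural recursion that defines \<open>z\<close> from the fixed
  continuation \<open>kl V z \<cdot> v\<close>; no order is involved.\<close>

lemma big_step_fixpoint_absorbs_kappa:
  assumes z: "z \<in> hom C mu (To V)" "z \<cdot> iv = munit T V" "z \<cdot> ic = kl V (kl V z \<cdot> v) \<cdot> chi_V z"
  shows "kl V z \<cdot> kappa = z"
proof -
  let ?p = "kl V z \<cdot> v" and ?y = "kl V z \<cdot> kappa"
  have p: "?p \<in> hom C (Sco V mu) (To V)" and y: "?y \<in> hom C mu (To V)" "?y \<cdot> iv = munit T V"
    using z(1,2) by simp_all
  have "kl V z \<cdot> gamma_c = kl V ?p \<cdot> chi_V ?y"
  proof (rule coproduct_eqI[OF K_coproduct, of _ "To V"])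
    show "(kl V z \<cdot> gamma_c) \<cdot> Sca iv (idn C mu) = (kl V ?p \<cdot> chi_V ?y) \<cdot> Sca iv (idn C mu)"
      unfolding kl_X_iv[OF y p] using z(1) by (simp add: v_def)
    \<comment> \<open>On this summand both sides are a step of the first argument followed by the
      Kleisli extension of \<open>z \<cdot> ic\<close>.\<close>
    show "(kl V z \<cdot> gamma_c) \<cdot> J = (kl V ?p \<cdot> chi_V ?y) \<cdot> J"
      unfolding kl_gamma_c_J[OF z(1)] kl_X_kappa[OF z(1) p] z(3) ..
  qed (use z(1) in simp_all)
  then have "?y \<cdot> ic = kl V ?p \<cdot> chi_V ?y" using z(1) by simp
  then show ?thesis using structural_recursion_eqI[OF p y(1) z(1) y(2) z(2) _ z(3)] by blast
qed

lemma le_chi: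
  assumes "le U Y f g" "f \<in> hom C U (To Y)" "g \<in> hom C U (To Y)"
  shows "le (Sco U Z) (Sco Y Z) (\<chi> Y Z \<cdot> Sca f (idn C Z)) (\<chi> Y Z \<cdot> Sca g (idn C Z))"
  by (rule omega_cont_mono[OF chi_cont[unfolded chi_omega_continuous_def, rule_format] hom_omega_cpo])
     (fact assms)+

text \<open>Since \<open>\<lblot>\<eta>, \<bottom>\<rblot>\<close> lies below the unit of \<open>U \<oplus> Y\<close>, monotonicity of \<open>\<chi>\<close> puts its image on the
  summand \<open>\<Theta>\<close> below \<open>\<eta> \<cdot> \<theta>\<close>; a map out of the coproduct can be chosen freely on that summand.\<close>

lemma chi_bot_le:
  assumes b: "is_bot (hom C Y (To U)) (le Y U) b"
    and p: "p \<in> hom C (Sco U Z) (To W)" and q: "q \<in> hom C (\<Theta>o U Y Z) (To W)"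
  shows "le (\<Theta>o U Y Z) W (kl W p \<cdot> \<chi> U Z \<cdot> Sca \<lblot>munit T U, b\<rblot> (idn C Z) \<cdot> \<theta> U Y Z) q"
proof -
  let ?P = "U \<oplus> Y" and ?i = "cinl C U Y" and ?j = "cinr C U Y"
  let ?bi = "Ta ?i \<cdot> b"
  have b': "b \<in> arrs C" "src C b = Y" "tgt C b = To U" using b unfolding is_bot_def by auto
  \<comment> \<open>\<open>c\<close> behaves as \<open>p\<close> when the first argument comes from
    \<open>U\<close> and as the prescribed \<open>q\<close> on the other summand.\<close>
  obtain c where c: "c \<in> hom C (Sco ?P Z) (To W)" "c \<cdot> Sca ?i (idn C Z) = p" "c \<cdot> \<theta> U Y Z = q"
    using coproduct[of U Z Y] p q unfolding is_coproduct_def by blast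
  have "is_bot (hom C Y (To ?P)) (le Y ?P) ?bi"
    using klift_bot[OF _ b, of "munit T ?P \<cdot> ?i" ?P] Ta_eq_kl[of ?i] by simp
  then have "le Y ?P ?bi (munit T ?P \<cdot> ?j)" unfolding is_bot_def by simp
  then have "le ?P ?P \<lblot>munit T ?P \<cdot> ?i, ?bi\<rblot> \<lblot>munit T ?P \<cdot> ?i, munit T ?P \<cdot> ?j\<rblot>"
    using b' by (intro le_copair_right) simp_all
  moreover have "\<lblot>munit T ?P \<cdot> ?i, munit T ?P \<cdot> ?j\<rblot> = munit T ?P"
    by (rule copair_eqI[of _ U Y "To ?P"]) simp_all
  moreover have "Ta ?i \<cdot> \<lblot>munit T U, b\<rblot> = \<lblot>munit T ?P \<cdot> ?i, ?bi\<rblot>"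
    using b' by (simp add: cmp_copair Ta_munit)
  ultimately have "le ?P ?P (Ta ?i \<cdot> \<lblot>munit T U, b\<rblot>) (munit T ?P)" by simp
  then have "le (Sco ?P Z) (Sco ?P Z) (\<chi> ?P Z \<cdot> Sca (Ta ?i \<cdot> \<lblot>munit T U, b\<rblot>) (idn C Z))
      (\<chi> ?P Z \<cdot> Sca (munit T ?P) (idn C Z))"
    by (rule le_chi) (use b' in simp_all)
  then have "le (\<Theta>o U Y Z) (Sco ?P Z)
      ((\<chi> ?P Z \<cdot> Sca (Ta ?i \<cdot> \<lblot>munit T U, b\<rblot>) (idn C Z)) \<cdot> \<theta> U Y Z)
      ((\<chi> ?P Z \<cdot> Sca (munit T ?P) (idn C Z)) \<cdot> \<theta> U Y Z)"
    by (rule le_precomp) (use b' in simp_all)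
  then have le: "le (\<Theta>o U Y Z) W
      (kl W c \<cdot> (\<chi> ?P Z \<cdot> Sca (Ta ?i \<cdot> \<lblot>munit T U, b\<rblot>) (idn C Z)) \<cdot> \<theta> U Y Z)
      (kl W c \<cdot> (\<chi> ?P Z \<cdot> Sca (munit T ?P) (idn C Z)) \<cdot> \<theta> U Y Z)"
    by (rule le_kl_right) (use b' c(1) in simp_all)
  have "kl W c \<cdot> (\<chi> ?P Z \<cdot> Sca (munit T ?P) (idn C Z)) \<cdot> \<theta> U Y Z = q"
    unfolding \<chi>_munit using c(1,3) by simp
  \<comment> \<open>Naturality moves the injection of \<open>U\<close> through
    \<open>\<chi>\<close>, so on this side only the branch \<open>p\<close> of \<open>c\<close> is
    reached.\<close>
  moreover have "kl W c \<cdot> (\<chi> ?P Z \<cdot> Sca (Ta ?i \<cdot> \<lblot>munit T U, b\<rblot>) (idn C Z)) \<cdot> \<theta> U Y Z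
    = kl W p \<cdot> \<chi> U Z \<cdot> Sca \<lblot>munit T U, b\<rblot> (idn C Z) \<cdot> \<theta> U Y Z"
  proof -
    have "\<chi> ?P Z \<cdot> Sca (Ta ?i \<cdot> \<lblot>munit T U, b\<rblot>) (idn C Z)
      = (\<chi> ?P Z \<cdot> Sca (Ta ?i) (idn C Z)) \<cdot> Sca \<lblot>munit T U, b\<rblot> (idn C Z)"
      using b' by (simp add: Sca_Sca)
    also have "\<chi> ?P Z \<cdot> Sca (Ta ?i) (idn C Z) = Ta (Sca ?i (idn C Z)) \<cdot> \<chi> U Z"
      by (rule \<chi>_natural[symmetric]) simp_all
    finally have "kl W c \<cdot> (\<chi> ?P Z \<cdot> Sca (Ta ?i \<cdot> \<lblot>munit T U, b\<rblot>) (idn C Z)) \<cdot> \<theta> U Y Z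
      = (kl W c \<cdot> Ta (Sca ?i (idn C Z))) \<cdot> \<chi> U Z \<cdot> Sca \<lblot>munit T U, b\<rblot> (idn C Z) \<cdot> \<theta> U Y Z"
      using b' c(1) by simp
    also have "kl W c \<cdot> Ta (Sca ?i (idn C Z)) = kl W p"
      using c(1,2) by (simp add: kl_Ta)
    finally show ?thesis .
  qed
  ultimately show ?thesis using le by simp
qed

section \<open>The small-step functional and its least fixpoint\<close>

abbreviation "small f \<equiv> klift C T V \<lblot>munit T V, f\<rblot> \<cdot> Ta (inv_arr C iota) \<cdot> gamma_c"

lemma small_eq:
  assumes "f \<in> hom C K (To V)"
  shows "small f = kl V (hat f) \<cdot> gamma_c"
proof -
  have "kl V \<lblot>munit T V, f\<rblot> \<cdot> Ta e \<cdot> gamma_c = (kl V \<lblot>munit T V, f\<rblot> \<cdot> Ta e) \<cdot> gamma_c"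
    using assms by simp
  also have "kl V \<lblot>munit T V, f\<rblot> \<cdot> Ta e = kl V (hat f)"
    using assms by (intro kl_Ta) simp_all
  finally show ?thesis by (simp add: e_def)
qed

lemma hat_cont: "omega_cont (hom C K (To V)) (le K V) (hom C mu (To V)) (le mu V) (\<lambda>f. hat f)"
  by (rule omega_cont_comp[OF copair_right_cont precomp_cont hom_omega_cpo]) simp_all

lemma le_hat:
  "\<lbrakk>le K V f g; f \<in> hom C K (To V); g \<in> hom C K (To V)\<rbrakk> \<Longrightarrow> le mu V (hat f) (hat g)"
  using omega_cont_mono[OF hat_cont hom_omega_cpo] by blast

lemma small_cont: "omega_cont (hom C K (To V)) (le K V) (hom C K (To V)) (le K V) (\<lambda>f. small f)"
proof -
  have "omega_cont (hom C K (To V)) (le K V) (hom C K (To V)) (le K V) (\<lambda>f. kl V (hat f) \<cdot> gamma_c)"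
    by (rule omega_cont_comp[OF hat_cont klift_cont_right hom_omega_cpo]) simp_all
  then show ?thesis
    using small_eq unfolding omega_cont_def omega_chain_def is_sup_def by (simp del: in_hom_iff)
qed

text \<open>\<open>kappa\<close> leaves values in place, hence on all of \<open>mu\<close> one
  unfolding of the small-step functional is a Kleisli composition with \<open>kappa\<close>.\<close>

lemma hat_small:
  assumes "f \<in> hom C K (To V)"
  shows "hat (kl V (hat f) \<cdot> gamma_c) = kl V (hat f) \<cdot> kappa"
  by (rule mu_eqI[of _ "To V"]) (use assms in simp_all)

lemma le_KI:
  assumes "f \<in> hom C K (To V)" "g \<in> hom C K (To V)"
    "le (Sco V mu) V (f \<cdot> Sca iv (idn C mu)) (g \<cdot> Sca iv (idn C mu))" "le (\<Theta>o V K mu) V (f \<cdot> J) (g \<cdot> J)"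
  shows "le K V f g"
  using le_coproductI[OF K_coproduct assms] .

lemma beta_arr [simp]: "beta le \<in> arrs C" "src C (beta le) = K" "tgt C (beta le) = To V"
  using least_fixpoint_closed[OF hom_omega_cpo small_cont] unfolding beta_def by auto

lemma beta_induct:
  assumes "\<And>b. is_bot (hom C K (To V)) (le K V) b \<Longrightarrow> P b"
    and "\<And>f. \<lbrakk>f \<in> hom C K (To V); P f\<rbrakk> \<Longrightarrow> P (small f)"
    and "\<And>f s. \<lbrakk>omega_chain (hom C K (To V)) (le K V) f; is_sup (hom C K (To V)) (le K V) f s;
      \<And>i. P (f i)\<rbrakk> \<Longrightarrow> P s"
  shows "P (beta le)"
  unfolding beta_def by (rule fixpoint_induct[OF hom_omega_cpo small_cont]) (fact assms)+

lemma beta_fixpoint: "kl V (hat (beta le)) \<cdot> gamma_c = beta le"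
  using least_fixpoint_unfold[OF hom_omega_cpo small_cont] small_eq[of "beta le"]
  unfolding beta_def[symmetric] by simp

lemma beta_big_step:
  "beta le = kl V (kl V (hat (beta le)) \<cdot> v) \<cdot> chi_V (hat (beta le))"
proof -
  let ?b = "beta le"
  let ?p = "kl V (hat ?b) \<cdot> v"
  \<comment> \<open>Only the evaluation of the first argument varies with \<open>f\<close>; the
    continuation \<open>?p\<close> is frozen at \<open>?b\<close>.\<close>
  let ?A = "\<lambda>f. kl V ?p \<cdot> chi_V (hat f)"
  let ?H = "hom C K (To V)"
  have b: "?b \<in> ?H" and p: "?p \<in> hom C (Sco V mu) (To V)" by simp_all
  have small_b: "small ?b = ?b" using small_eq[OF b] beta_fixpoint by simp
  have small_H: "small f \<in> ?H" if "f \<in> ?H" for f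
    unfolding small_eq[OF that] using that by simp
  have A_H: "?A f \<in> ?H" if "f \<in> ?H" for f using that by simp
  have small_iv: "small f \<cdot> Sca iv (idn C mu) = kl V (hat f) \<cdot> v" if "f \<in> ?H" for f
    unfolding small_eq[OF that] using that by (simp add: v_def)
  have small_J: "small f \<cdot> J = (kl V f \<cdot> step) \<cdot> J" if "f \<in> ?H" for f
    unfolding small_eq[OF that] using that kl_gamma_c_J[of "hat f"] by simp
  have A_iv: "?A f \<cdot> Sca iv (idn C mu) = ?p" if "f \<in> ?H" for f
    using that by (intro kl_X_iv p) simp_all
  have A_small: "?A (small f) = kl V (?A f) \<cdot> step" if "f \<in> ?H" for f
    unfolding small_eq[OF that] hat_small[OF that] using that by (intro kl_X_kappa p) simp
  have b_iv: "?b \<cdot> Sca iv (idn C mu) = ?p" using small_iv[OF b] small_b by simp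
  have b_J: "?b \<cdot> J = (kl V ?b \<cdot> step) \<cdot> J" using small_J[OF b] small_b by simp
  have A_b: "?A ?b = kl V (?A ?b) \<cdot> step" using A_small[OF b] unfolding small_b .
  have le_step: "le (\<Theta>o V K mu) V ((kl V f \<cdot> step) \<cdot> J) ((kl V g \<cdot> step) \<cdot> J)"
    if "le K V f g" "f \<in> ?H" "g \<in> ?H" for f g
    by (rule le_precomp[OF le_kl_left[OF that]]) (use that in simp_all)
  have small_mono: "le K V (small f) (small g)" if "le K V f g" "f \<in> ?H" "g \<in> ?H" for f g
    using omega_cont_mono[OF small_cont hom_omega_cpo that(2,3,1)] .
  \<comment> \<open>The bound by \<open>?b\<close> is carried through the induction because on the
    value summand \<open>small f\<close> has continuation \<open>hat f\<close>, which must be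
    compared with the \<open>hat ?b\<close> inside \<open>?p\<close>.\<close>
  have "le K V ?b ?b \<and> le K V ?b (?A ?b)"
  proof (rule beta_induct[where P = "\<lambda>f. le K V f ?b \<and> le K V f (?A ?b)"])
    show "le K V c ?b \<and> le K V c (?A ?b)" if "is_bot ?H (le K V) c" for c
      using that b A_H[OF b] unfolding is_bot_def by blast
    show "le K V (small f) ?b \<and> le K V (small f) (?A ?b)"
      if f: "f \<in> ?H" and le: "le K V f ?b \<and> le K V f (?A ?b)" for f
    proof
      show "le K V (small f) ?b" using small_mono[OF conjunct1[OF le] f b] unfolding small_b .
      show "le K V (small f) (?A ?b)"
      proof (rule le_KI[OF small_H[OF f] A_H[OF b]])
        show "le (Sco V mu) V (small f \<cdot> Sca iv (idn C mu)) (?A ?b \<cdot> Sca iv (idn C mu))"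
          unfolding small_iv[OF f] A_iv[OF b]
          by (rule le_kl_left[OF le_hat[OF conjunct1[OF le] f b]]) (use f in simp_all)
        \<comment> \<open>\<open>?A ?b\<close> satisfies the same step equation as
          \<open>?b\<close>, so the induction hypothesis is used after one
          \<open>step\<close>.\<close>
        show "le (\<Theta>o V K mu) V (small f \<cdot> J) (?A ?b \<cdot> J)"
          using le_step[OF conjunct2[OF le] f A_H[OF b]] small_J[OF f] A_b by simp
      qed
    qed
    show "le K V s ?b \<and> le K V s (?A ?b)"
      if "is_sup ?H (le K V) f s" "\<And>i. le K V (f i) ?b \<and> le K V (f i) (?A ?b)" for f s
      using that b A_H[OF b] unfolding is_sup_def by blast
  qed
  moreover have "le K V (?A ?b) ?b"
  proof (rule beta_induct[where P = "\<lambda>f. le K V (?A f) ?b"])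
    \<comment> \<open>\<open>?A c\<close> already equals \<open>?p\<close> on the value summand, so
      it need not be least; on the other summand \<open>chi_bot_le\<close> bounds it by any arrow,
      here by \<open>?b \<cdot> J\<close>.\<close>
    show "le K V (?A c) ?b" if c: "is_bot ?H (le K V) c" for c
    proof -
      have c': "c \<in> ?H" using c unfolding is_bot_def by blast
      show ?thesis
      proof (rule le_KI[OF A_H[OF c'] b])
        show "le (Sco V mu) V (?A c \<cdot> Sca iv (idn C mu)) (?b \<cdot> Sca iv (idn C mu))"
          unfolding A_iv[OF c'] b_iv using p by (rule le_refl)
        have "?A c \<cdot> J = kl V ?p \<cdot> \<chi> V mu \<cdot> Sca \<lblot>munit T V, c\<rblot> (idn C mu) \<cdot> \<theta> V K mu"
          using c' by (simp add: J_def Sca_Sca)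
        moreover have "le (\<Theta>o V K mu) V \<dots> (?b \<cdot> J)"
          by (rule chi_bot_le[OF c p]) simp
        ultimately show "le (\<Theta>o V K mu) V (?A c \<cdot> J) (?b \<cdot> J)" by simp
      qed
    qed
    show "le K V (?A (small f)) ?b" if f: "f \<in> ?H" and le: "le K V (?A f) ?b" for f
    proof (rule le_KI[OF A_H[OF small_H[OF f]] b])
      show "le (Sco V mu) V (?A (small f) \<cdot> Sca iv (idn C mu)) (?b \<cdot> Sca iv (idn C mu))"
        unfolding A_iv[OF small_H[OF f]] b_iv using p by (rule le_refl)
      show "le (\<Theta>o V K mu) V (?A (small f) \<cdot> J) (?b \<cdot> J)"
        unfolding A_small[OF f] b_J by (rule le_step[OF le A_H[OF f] b])
    qed
    \<comment> \<open>Admissibility of the second induction: \<open>?A\<close> is continuous as a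
      composite of \<open>hat\<close>, the lifting along \<open>\<chi>\<close> and Kleisli
      composition.\<close>
    have "omega_cont (hom C mu (To V)) (le mu V) (hom C K (To (Sco V mu))) (le K (Sco V mu)) (\<lambda>f. chi_V f)"
      using chi_cont unfolding chi_omega_continuous_def by (metis mu_simps(3))
    then have A_cont: "omega_cont ?H (le K V) ?H (le K V) ?A"
      by (rule omega_cont_comp[OF omega_cont_comp[OF hat_cont _ hom_omega_cpo] klift_cont_left[OF p] hom_omega_cpo])
    show "le K V (?A s) ?b"
      if "omega_chain ?H (le K V) f" "is_sup ?H (le K V) f s" "\<And>i. le K V (?A (f i)) ?b" for f s
    proof -
      have "is_sup ?H (le K V) (\<lambda>i. ?A (f i)) (?A s)"
        using A_cont that(1,2) unfolding omega_cont_def by blast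
      then show ?thesis using that(3) b unfolding is_sup_def by blast
    qed
  qed
  ultimately show ?thesis using le_antisym[OF _ _ b A_H[OF b]] by blast
qed

text \<open>Kleisli associativity merges the last two stages, and \<open>Fmult_xi\<close> turns the
  evaluated \<open>xi mu\<close> into \<open>v\<close>; this is the form in which
  \<open>beta_big_step\<close> applies.\<close>

lemma zeta_functional_eq:
  assumes "f \<in> hom C mu (To V)"
  shows "klift C T V f \<cdot> Ta (Fmult (zero C)) \<cdot> klift C T (Fo mu) (xi mu) \<cdot> \<chi> V mu \<cdot> Sca f (idn C mu)
    = kl V (kl V f \<cdot> v) \<cdot> chi_V f"
proof -
  have xi: "xi mu \<in> arrs C" "src C (xi mu) = Sco V mu" "tgt C (xi mu) = To (Fo mu)"
    by (simp_all add: xi_def rho_cv_def)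
  have "kl V f \<cdot> Ta (Fmult (zero C)) \<cdot> kl (Fo mu) (xi mu) \<cdot> chi_V f
    = (kl V f \<cdot> (Ta (Fmult (zero C)) \<cdot> kl (Fo mu) (xi mu))) \<cdot> chi_V f"
    using assms xi by simp
  also have "Ta (Fmult (zero C)) \<cdot> kl (Fo mu) (xi mu) = kl mu v"
    using xi by (simp add: Ta_kl Fmult_xi)
  also have "kl V f \<cdot> kl mu v = kl V (kl V f \<cdot> v)"
    using assms by (intro kl_kl) simp_all
  finally show ?thesis .
qed

theorem zeta_hat_eq_beta_hat: "zeta_hat le = beta_hat le"
proof -
  let ?\<Phi> = "\<lambda>f. \<lblot>munit T V, klift C T V f \<cdot> Ta (Fmult (zero C)) \<cdot> klift C T (Fo mu) (xi mu)
    \<cdot> \<chi> V mu \<cdot> Sca f (idn C mu)\<rblot> \<cdot> inv_arr C iota"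
  have \<Phi>: "?\<Phi> f = hat (kl V (kl V f \<cdot> v) \<cdot> chi_V f)" if "f \<in> hom C mu (To V)" for f
    using zeta_functional_eq[OF that] by (simp add: e_def)
  have "least_fixpoint (hom C mu (To V)) (le mu V) ?\<Phi> = hat (beta le)"
  proof (rule least_fixpoint_eqI[OF hom_omega_cpo])
    show hb: "hat (beta le) \<in> hom C mu (To V)" by simp
    show "?\<Phi> (hat (beta le)) = hat (beta le)"
      unfolding \<Phi>[OF hb] by (simp flip: beta_big_step)
    \<comment> \<open>For leastness, any big-step fixpoint \<open>z\<close> is shown to come from a
      small-step fixpoint, namely \<open>z \<cdot> ic\<close>, and leastness of
      \<open>beta le\<close> is applied to that.\<close>
    fix z
    assume z: "z \<in> hom C mu (To V)" "?\<Phi> z = z"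
    then have z_eq: "hat (kl V (kl V z \<cdot> v) \<cdot> chi_V z) = z" using \<Phi>[OF z(1)] by simp
    have A: "kl V (kl V z \<cdot> v) \<cdot> chi_V z \<in> hom C K (To V)" using z(1) by simp
    have iv: "z \<cdot> iv = munit T V" and ic: "z \<cdot> ic = kl V (kl V z \<cdot> v) \<cdot> chi_V z"
      using hat_iota[of "kl V (kl V z \<cdot> v) \<cdot> chi_V z"] A unfolding z_eq by simp_all
    have absorb: "kl V z \<cdot> kappa = z" by (rule big_step_fixpoint_absorbs_kappa[OF z(1) iv ic])
    have hat_z: "hat (z \<cdot> ic) = z" using z_eq ic by simp
    have zic: "z \<cdot> ic \<in> hom C K (To V)" using z(1) by simp
    have "small (z \<cdot> ic) = kl V z \<cdot> gamma_c" unfolding small_eq[OF zic] hat_z ..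
    \<comment> \<open>Recognising \<open>gamma_c\<close> as \<open>kappa \<cdot> ic\<close> lets the
      absorption of \<open>kappa\<close> by \<open>z\<close> close the equation.\<close>
    also have "\<dots> = (kl V z \<cdot> kappa) \<cdot> ic" using z(1) by simp
    finally have "small (z \<cdot> ic) = z \<cdot> ic" unfolding absorb .
    then have "le K V (beta le) (z \<cdot> ic)"
      unfolding beta_def by (rule least_fixpoint_least[OF hom_omega_cpo small_cont zic])
    from le_hat[OF this _ zic] show "le mu V (hat (beta le)) z" unfolding hat_z by simp
  qed
  then show ?thesis unfolding zeta_hat_def beta_hat_def by (simp add: e_def)
qed

end

theorem theorem5p4:
  fixes C :: "('o, 'm) bicart"
    and Sv :: "('o, 'm, 'o, 'm) func"
    and Sc :: "('o \<times> 'o, 'm \<times> 'm, 'o, 'm) func"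
    and F :: "('o, 'm) free_algs"
    and D :: "('o \<times> 'o, 'm \<times> 'm, 'o, 'm) func"
    and \<Theta> :: "('o \<times> 'o \<times> 'o, 'm \<times> 'm \<times> 'm, 'o, 'm) func"
    and \<theta> :: "'o \<Rightarrow> 'o \<Rightarrow> 'o \<Rightarrow> 'm"
    and T :: "('o, 'm) smonad"
    and le :: "'o \<Rightarrow> 'o \<Rightarrow> 'm \<Rightarrow> 'm \<Rightarrow> bool"
    and \<rho>v :: "'o \<Rightarrow> 'm"
    and \<rho>c :: "'o \<Rightarrow> 'o \<Rightarrow> 'm"
    and \<chi> :: "'o \<Rightarrow> 'o \<Rightarrow> 'm"
  assumes "distributive_category C"
    and "is_functor C C Sv"
    and "is_functor (C \<times>\<^sub>C C) C Sc"
    and "free_algebras C (sig_functor C Sv Sc) F"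
    and "is_functor (op_cat C \<times>\<^sub>C C) C D"
    and "computation_splitting C Sc \<Theta> \<theta>"
    and "omega_continuous_monad C T le"
    and "separated_law C Sv Sc F T D \<rho>v \<rho>c \<chi>"
    and "hogsos.strongly_separated C Sv Sc F T D \<rho>c \<chi> \<theta>"
    and "hogsos.chi_omega_continuous C Sc T \<chi> le"
  shows "hogsos.zeta_hat C Sv Sc F T D \<rho>v \<rho>c \<chi> le = hogsos.beta_hat C Sv Sc F T D \<rho>v \<rho>c le"
proof -
  interpret separated_semantics C Sv Sc F T D \<rho>v \<rho>c \<chi> le \<Theta> \<theta>
    using assms by (intro separated_semantics.intro hogsos_syntax.intro distributive_monad.intro
      hogsos_syntax_axioms.intro separated_semantics_axioms.intro)
  show ?thesis by (rule zeta_hat_eq_beta_hat)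
qed

end
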